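(* Let $m,n\ge1$ be integers, $\omega>0$, and let $\mathbf v\in\mathbb C^m$ with $\|\mathbf v\|=1$. For $\sigma>0$ let $H\sim\mathcal{CW}_m(n,\sigma^2I_m,(\omega/\sigma^2)\mathbf v\mathbf v^\dagger)$ and let $\ell_1(\sigma)$ be the largest eigenvalue of $H$. Then, with $(m,n,\omega)$ fixed, as $\sigma\to0$, $$\ell_1(\sigma)=\frac{\sigma^2}{2}\left[A+B+\frac{B\cdot C}{A}\right]+o(\sigma^4),$$ where $A,B,C$ are independent random variables distributed as $A\sim\chi^2_{2n}(2\omega/\sigma^2)$, $B\sim\chi^2_{2m-2}$, $C\sim\chi^2_{2n-2}$.
   Context: $\dagger$ denotes conjugate transpose. $\mathcal{CN}(\mu,\Sigma)$ is the circularly symmetric complex Gaussian law with mean $\mu$ and covariance $\mathbb E[(x-\mu)(x-\mu)^\dagger]=\Sigma$. $\mathcal{CW}_m(n,\Sigma,\Omega)$ is the non-central complex Wishart law with non-centrality matrix $\Omega$, i.e. the law of $\sum_{j=1}^n x_jx_j^\dagger$ with $x_j\sim\mathcal{CN}(\mu_j,\Sigma)$ independent in $\mathbb C^m$ and $\Omega=\Sigma^{-1}\sum_{j=1}^n\mu_j\mu_j^\dagger$. $\chi^2_k$ is the (real) chi-squared law with $k$ degrees of freedom ($\chi^2_0\equiv0$), and $\chi^2_k(\delta)$ is the non-central chi-squared law with non-centrality parameter $\delta$ (the law of $\sum_{i=1}^k g_i^2$ with $g_i\sim N(a_i,1)$ independent and $\sum a_i^2=\delta$). The displayed equality is a stochastic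 representation: the matrices $H$ (for all small $\sigma>0$) and the variables $A,B,C$ (which have the stated joint law for each $\sigma$) can be realized on a common probability space so that the equality holds, where $o(\sigma^4)$ denotes a random remainder which, divided by $\sigma^4$, tends to $0$ in probability as $\sigma\to0$. *)

theory Defs
  imports "HOL-Probability.Probability"
begin

text \<open>The matrix \<open>x x\<^sup>\<dagger>\<close>.\<close>

definition outer :: "complex ^ 'm \<Rightarrow> complex ^ 'm ^ 'm" where
  "outer x = (\<chi> i j. x $ i * cnj (x $ j))"

text \<open>
  The circularly symmetric complex Gaussian law, for Hermitian positive definite \<open>S\<close>: density
  \<open>exp (- (x - \<mu>)\<^sup>\<dagger> S\<^sup>-\<^sup>1 (x - \<mu>)) / (pi ^ m * det S)\<close>, where \<^const>\<open>lborel\<close> on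
  \<open>complex ^ 'm\<close> is Lebesgue measure in the real and imaginary parts of the coordinates.
  The quadratic form and the determinant are real for such \<open>S\<close>, so \<^const>\<open>Re\<close> is only a
  type conversion. The covariance is \<open>S\<close>, so for \<open>S = s\<^sup>2 I\<close> each real and imaginary part has
  variance \<open>s\<^sup>2 / 2\<close>.
\<close>

definition complex_normal :: "complex ^ 'm \<Rightarrow> complex ^ 'm ^ 'm \<Rightarrow> (complex ^ 'm) measure" where
  "complex_normal \<mu> S = density lborel (\<lambda>x. ennreal
     (exp (- Re (\<Sum>i\<in>UNIV. cnj ((x - \<mu>) $ i) * (matrix_inv S *v (x - \<mu>)) $ i))
      / (pi ^ CARD('m) * Re (det S))))"

text \<open>
  The law below depends on the means \<open>\<mu>\<close> only through the non-centrality matrix \<open>\<Omega>\<close>, so at most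
  one \<open>W\<close> satisfies the predicate for given \<open>n\<close>, \<open>S\<close>, \<open>\<Omega>\<close>; the same holds for the non-central
  chi-squared law and its parameter \<open>\<delta>\<close>.
\<close>

definition is_noncentral_wishart ::
    "nat \<Rightarrow> complex ^ 'm ^ 'm \<Rightarrow> complex ^ 'm ^ 'm \<Rightarrow> (complex ^ 'm ^ 'm) measure \<Rightarrow> bool" where
  "is_noncentral_wishart n S \<Omega> W \<longleftrightarrow>
     (\<exists>\<mu>. \<Omega> = matrix_inv S ** (\<Sum>j<n. outer (\<mu> j)) \<and>
          W = distr (\<Pi>\<^sub>M j\<in>{..<n}. complex_normal (\<mu> j) S) borel (\<lambda>x. \<Sum>j<n. outer (x j)))"

definition is_noncentral_chi_squared :: "nat \<Rightarrow> real \<Rightarrow> real measure \<Rightarrow> bool" where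
  "is_noncentral_chi_squared k \<delta> N \<longleftrightarrow>
     (\<exists>a. (\<Sum>i<k. (a i)\<^sup>2) = \<delta> \<and>
          N = distr (\<Pi>\<^sub>M i\<in>{..<k}. density lborel (\<lambda>x. ennreal (normal_density (a i) 1 x)))
                borel (\<lambda>g. \<Sum>i<k. (g i)\<^sup>2))"

text \<open>For \<open>k = 0\<close> this is the point mass at \<open>0\<close>.\<close>

definition chi_squared :: "nat \<Rightarrow> real measure" where
  "chi_squared k =
     distr (\<Pi>\<^sub>M i\<in>{..<k}. density lborel (\<lambda>x. ennreal (std_normal_density x)))
       borel (\<lambda>g. \<Sum>i<k. (g i)\<^sup>2)"

text \<open>
  Meaningful for Hermitian matrices, which have a nonempty finite set of eigenvalues, all real.
\<close>

definition largest_eigenvalue :: "complex ^ 'm ^ 'm \<Rightarrow> real" where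
  "largest_eigenvalue H =
     Max {l :: real. \<exists>x. x \<noteq> 0 \<and> H *v x = complex_of_real l *s x}"

definition tendsto_zero_in_prob :: "'w measure \<Rightarrow> ('i \<Rightarrow> 'w \<Rightarrow> real) \<Rightarrow> 'i filter \<Rightarrow> bool" where
  "tendsto_zero_in_prob M X F \<longleftrightarrow>
     (\<forall>\<epsilon>>0. ((\<lambda>i. measure M {w \<in> space M. \<bar>X i w\<bar> > \<epsilon>}) \<longlongrightarrow> 0) F)"

end

theory Submission
  imports Defs
begin

text \<open>
  Write \<open>H = X X\<^sup>\<dagger>\<close>, where \<open>X\<close> has \<open>n\<close> independent Gaussian columns, and put \<open>s = \<sigma> / sqrt 2\<close>. Let
  \<open>r\<close> be the row \<open>v\<^sup>\<dagger> X\<close>. A unitary map of the columns that depends only on \<open>r\<close> and takes \<open>r\<close> to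
  \<open>(\<alpha>, 0, \<dots>, 0)\<close> with \<open>|\<alpha>| = |r|\<close> keeps the part of \<open>X\<close> orthogonal to \<open>v\<close> Gaussian, so \<open>H\<close> has the law
  of \<open>z z\<^sup>\<dagger> + s\<^sup>2 (\<Sum>0<j<n. d\<^sub>j d\<^sub>j\<^sup>\<dagger>)\<close> with \<open>z = \<alpha> v + s b\<close>, where \<open>b\<close> and the \<open>d\<^sub>j\<close> are independent standard
  Gaussian vectors in the orthogonal complement of \<open>v\<close>. By rotation invariance the components of the \<open>d\<^sub>j\<close>
  along \<open>b\<close> may be replaced by fresh Gaussian variables \<open>c\<^sub>j\<close>. Then \<open>A = |\<alpha>|\<^sup>2 / s\<^sup>2\<close>, \<open>B = |b|\<^sup>2\<close> and
  \<open>C = (\<Sum>0<j<n. |c\<^sub>j|\<^sup>2)\<close> are functions of disjoint sets of coordinates, and the secular equation of the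
  rank-one perturbation gives the largest eigenvalue as \<open>s\<^sup>2 (A + B + B C / A)\<close> up to \<open>O(s\<^sup>6)\<close>, at every
  sample point.
\<close>

section \<open>Rotation invariance of Gaussian measures\<close>

text \<open>The rotation of the columns is random, so it is never formed as one matrix. It is a
  chain of orthogonal maps, each acting on two of the Gaussian vectors and determined by the others;
  Fubini then reduces every step to a fixed orthogonal map. No basis of the complement of
  \<open>v\<close> is chosen: components are swapped with coordinates of reservoir vectors instead.
  The components along \<open>b\<close> are replaced for the sake of independence. The perturbation
  sees the \<open>d\<^sub>j\<close> to leading order only through the squared products with
  \<open>b\<close>, and after the replacement their sum is |b|^2 times a sum in which
  \<open>b\<close> no longer occurs. Only \<alpha> depends on \<sigma>; the sample space,
  \<open>b\<close> and the \<open>d\<^sub>j\<close> do not. At a fixed sample point the error is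
  thus bounded by a constant times \<sigma>^6 / |\<alpha>|^4 for small \<sigma>, where |\<alpha>|^2
  tends to \<omega> > 0. Convergence in probability comes from this pointwise convergence.\<close>

lemma nn_integral_lborel_translate:
  fixes f :: "'a::euclidean_space \<Rightarrow> ennreal"
  assumes [measurable]: "f \<in> borel_measurable borel"
  shows "(\<integral>\<^sup>+x. f (x + a) \<partial>lborel) = (\<integral>\<^sup>+x. f x \<partial>lborel)"
proof -
  have "(\<integral>\<^sup>+x. f x \<partial>lborel) = (\<integral>\<^sup>+x. f x \<partial>distr lborel borel (\<lambda>x. a + x))"
    using lborel_affine[of 1 a] by (simp add: density_1)
  also have "\<dots> = (\<integral>\<^sup>+x. f (x + a) \<partial>lborel)"
    by (subst nn_integral_distr) (simp_all add: add.commute)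
  finally show ?thesis by simp
qed

text \<open>
  Comparing the two orders of integration of \<open>f (x + y) g y\<close>, with \<open>g\<close> the indicator of the unit
  ball, shows that Lebesgue measure and its image under \<open>T\<close> agree up to the ratio of the measures
  they give to the ball, which is \<open>1\<close>.
\<close>
lemma lborel_distr_orthogonal:
  fixes T :: "'a::euclidean_space \<Rightarrow> 'a"
  assumes T: "orthogonal_transformation T"
  shows "distr lborel borel T = lborel"
proof (rule measure_eqI)
  fix X assume "X \<in> sets (distr lborel borel T)"
  then have X[measurable]: "X \<in> sets borel" by simp
  have lin: "linear T" using T by (simp add: orthogonal_transformation_def)
  have [measurable]: "T \<in> borel_measurable borel"
    by (intro borel_measurable_continuous_onI linear_continuous_on linear_conv_bounded_linear[THEN iffD1] lin)
  have nT: "norm (T x) = norm x" for x using T by (simp add: orthogonal_transformation)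
  obtain T' where T': "linear T'" "\<And>x. T (T' x) = x"
    using orthogonal_transformation_surj[OF T] lin
    by (metis linear_surjective_right_inverse comp_apply id_apply)
  let ?f = "indicator X :: 'a \<Rightarrow> ennreal" and ?g = "indicator (ball 0 1) :: 'a \<Rightarrow> ennreal"
  have [measurable]: "ball (0::'a) 1 \<in> sets borel" by simp
  have g_even: "?g (- x) = ?g x" for x by (simp add: indicator_def)
  have gT: "?g (T x) = ?g x" for x by (simp add: indicator_def nT)
  have f_tr: "(\<integral>\<^sup>+x. ?f (T x + y) \<partial>lborel) = (\<integral>\<^sup>+x. ?f (T x) \<partial>lborel)" for y
  proof -
    have "(\<integral>\<^sup>+x. ?f (T x + y) \<partial>lborel) = (\<integral>\<^sup>+x. ?f (T (x + T' y)) \<partial>lborel)"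
      by (simp add: linear_add[OF lin] T')
    also have "\<dots> = (\<integral>\<^sup>+x. ?f (T x) \<partial>lborel)"
      by (rule nn_integral_lborel_translate[where f = "\<lambda>x. ?f (T x)"]) measurable
    finally show ?thesis .
  qed
  have g_tr: "(\<integral>\<^sup>+x. ?g (y - T x) \<partial>lborel) = (\<integral>\<^sup>+x. ?g x \<partial>lborel)" for y
  proof -
    have "(\<integral>\<^sup>+x. ?g (y - T x) \<partial>lborel) = (\<integral>\<^sup>+x. ?g (T (x + T' (- y))) \<partial>lborel)"
      by (subst g_even[symmetric]) (simp add: linear_add[OF lin] T')
    also have "\<dots> = (\<integral>\<^sup>+x. ?g x \<partial>lborel)"
      unfolding gT by (rule nn_integral_lborel_translate) measurable
    finally show ?thesis .
  qed
  have "(\<integral>\<^sup>+x. ?f (T x) \<partial>lborel) * (\<integral>\<^sup>+y. ?g y \<partial>lborel) =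
      (\<integral>\<^sup>+y. (\<integral>\<^sup>+x. ?f (T x + y) * ?g y \<partial>lborel) \<partial>lborel)"
    by (simp add: nn_integral_multc nn_integral_cmult f_tr del: nn_integral_indicator)
  also have "\<dots> = (\<integral>\<^sup>+x. (\<integral>\<^sup>+y. ?f (T x + y) * ?g y \<partial>lborel) \<partial>lborel)"
    by (rule lborel_pair.Fubini') measurable
  also have "\<dots> = (\<integral>\<^sup>+x. (\<integral>\<^sup>+y. ?f y * ?g (y - T x) \<partial>lborel) \<partial>lborel)"
  proof (rule nn_integral_cong)
    fix x :: 'a
    show "(\<integral>\<^sup>+y. ?f (T x + y) * ?g y \<partial>lborel) = (\<integral>\<^sup>+y. ?f y * ?g (y - T x) \<partial>lborel)"
      using nn_integral_lborel_translate[of "\<lambda>y. ?f y * ?g (y - T x)" "T x"]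
      by (simp add: add.commute)
  qed
  also have "\<dots> = (\<integral>\<^sup>+y. (\<integral>\<^sup>+x. ?f y * ?g (y - T x) \<partial>lborel) \<partial>lborel)"
    by (rule lborel_pair.Fubini') measurable
  also have "\<dots> = (\<integral>\<^sup>+y. ?f y \<partial>lborel) * (\<integral>\<^sup>+x. ?g x \<partial>lborel)"
    by (simp add: nn_integral_multc nn_integral_cmult g_tr del: nn_integral_indicator)
  finally have eq: "(\<integral>\<^sup>+x. ?f (T x) \<partial>lborel) * (\<integral>\<^sup>+y. ?g y \<partial>lborel) =
      (\<integral>\<^sup>+y. ?f y \<partial>lborel) * (\<integral>\<^sup>+x. ?g x \<partial>lborel)" .
  have g0: "(\<integral>\<^sup>+y. ?g y \<partial>lborel) \<noteq> 0" "(\<integral>\<^sup>+y. ?g y \<partial>lborel) \<noteq> \<infinity>"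
    using content_ball_pos[of 1 "0::'a"] emeasure_lborel_ball_finite[of "0::'a" 1]
    by (auto simp: emeasure_eq_ennreal_measure)
  have "(\<integral>\<^sup>+x. ?f (T x) \<partial>lborel) = (\<integral>\<^sup>+y. ?f y \<partial>lborel)"
    using arg_cong[OF eq, of "\<lambda>c. c / (\<integral>\<^sup>+y. ?g y \<partial>lborel)"] g0
    by (simp add: ennreal_mult_divide_eq del: nn_integral_indicator)
  moreover have "(\<integral>\<^sup>+x. ?f (T x) \<partial>lborel) = emeasure (distr lborel borel T) X"
    using nn_integral_distr[of T lborel borel ?f] by simp
  ultimately show "emeasure (distr lborel borel T) X = emeasure lborel X" by simp
qed simp

text \<open>Written through the norm rather than as a product over coordinates, so that invariance
  under orthogonal maps is inherited from Lebesgue measure. The type is any Euclidean space in order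
  to cover pairs of vectors too. On \<open>complex ^ 'm\<close> each real and imaginary part has
  variance 1.\<close>

definition gauss :: "'a::euclidean_space measure" where
  "gauss = density lborel
     (\<lambda>x. ennreal ((1 / sqrt (2 * pi)) ^ DIM('a) * exp (- (norm x)\<^sup>2 / 2)))"

abbreviation normal :: "real \<Rightarrow> real measure" where
  "normal a \<equiv> density lborel (\<lambda>x. ennreal (normal_density a 1 x))"

lemma sets_gauss [measurable_cong, simp]: "sets gauss = sets borel"
  by (simp add: gauss_def)

lemma space_gauss [simp]: "space gauss = UNIV"
  by (simp add: gauss_def)

lemma prob_space_normal: "prob_space (normal a)"
  by (rule prob_space_normal_density) simp

lemma gauss_distr_orthogonal:
  fixes T :: "'a::euclidean_space \<Rightarrow> 'a"
  assumes T: "orthogonal_transformation T"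
  shows "distr gauss borel T = gauss"
proof -
  have lin: "linear T" using T by (simp add: orthogonal_transformation_def)
  have [measurable]: "T \<in> borel_measurable borel"
    by (intro borel_measurable_continuous_onI linear_continuous_on linear_conv_bounded_linear[THEN iffD1] lin)
  have nT: "norm (T x) = norm x" for x using T by (simp add: orthogonal_transformation)
  let ?d = "\<lambda>x::'a. ennreal ((1 / sqrt (2 * pi)) ^ DIM('a) * exp (- (norm x)\<^sup>2 / 2))"
  have "gauss = density (distr lborel borel T) ?d"
    by (simp add: gauss_def lborel_distr_orthogonal[OF T])
  also have "\<dots> = distr (density lborel (\<lambda>x. ?d (T x))) borel T"
    by (rule density_distr) measurable
  also have "\<dots> = distr gauss borel T"
    by (simp add: gauss_def nT)
  finally show ?thesis by simp
qed

lemma gauss_density_prod: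
  fixes x :: "'a::euclidean_space"
  shows "ennreal ((1 / sqrt (2 * pi)) ^ DIM('a) * exp (- (norm x)\<^sup>2 / 2)) =
    (\<Prod>b\<in>Basis. ennreal (std_normal_density (x \<bullet> b)))"
proof -
  have "(norm x)\<^sup>2 = (\<Sum>b\<in>Basis. (x \<bullet> b)\<^sup>2)"
    by (subst power2_norm_eq_inner, subst euclidean_inner) (simp add: power2_eq_square)
  then have "exp (- (norm x)\<^sup>2 / 2) = (\<Prod>b\<in>Basis. exp (- (x \<bullet> b)\<^sup>2 / 2))"
    by (simp add: exp_sum[symmetric] sum_negf sum_divide_distrib)
  then show ?thesis
    by (subst prod_ennreal) (simp_all add: std_normal_density_def prod_dividef prod.distrib[symmetric] power_one_over field_simps)
qed

lemma emeasure_gauss_box: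
  assumes A: "\<And>b. b \<in> (Basis :: 'a::euclidean_space set) \<Longrightarrow> A b \<in> sets borel"
  shows "emeasure gauss {x::'a. \<forall>b\<in>Basis. x \<bullet> b \<in> A b} = (\<Prod>b\<in>Basis. emeasure (normal 0) (A b))"
proof -
  note [measurable] = A
  have [measurable]: "{x::'a. \<forall>b\<in>Basis. x \<bullet> b \<in> A b} \<in> sets borel"
    by measurable
  let ?h = "\<lambda>b t. ennreal (std_normal_density t) * indicator (A b) t"
  have "emeasure gauss {x::'a. \<forall>b\<in>Basis. x \<bullet> b \<in> A b} =
      (\<integral>\<^sup>+x. ennreal ((1 / sqrt (2 * pi)) ^ DIM('a) * exp (- (norm x)\<^sup>2 / 2)) *
        indicator {x::'a. \<forall>b\<in>Basis. x \<bullet> b \<in> A b} x \<partial>lborel)"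
    unfolding gauss_def by (rule emeasure_density) measurable
  also have "\<dots> = (\<integral>\<^sup>+x. (\<Prod>b\<in>(Basis::'a set). ?h b (x \<bullet> b)) \<partial>lborel)"
    unfolding gauss_density_prod prod.distrib
    by (intro nn_integral_cong arg_cong2[where f = "(*)"] refl)
      (auto simp: indicator_def prod_zero_iff)
  also have "\<dots> = (\<Prod>b\<in>Basis. \<integral>\<^sup>+t. ?h b t \<partial>lborel)"
    by (rule nn_integral_lborel_prod) (simp_all add: A)
  also have "\<dots> = (\<Prod>b\<in>Basis. emeasure (normal 0) (A b))"
    by (intro prod.cong refl, subst emeasure_density) (simp_all add: A)
  finally show ?thesis .
qed

lemma gauss_Basis_coordinates:
  "distr gauss (\<Pi>\<^sub>M b\<in>(Basis :: 'a::euclidean_space set). normal 0) (\<lambda>x. \<lambda>b\<in>Basis. x \<bullet> b) =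
    (\<Pi>\<^sub>M b\<in>(Basis :: 'a set). normal 0)"
proof -
  interpret product_prob_space "\<lambda>_::'a. normal 0"
    by (intro product_prob_spaceI prob_space_normal)
  have [measurable]: "(\<lambda>x::'a. \<lambda>b\<in>Basis. x \<bullet> b) \<in> gauss \<rightarrow>\<^sub>M (\<Pi>\<^sub>M b\<in>Basis. normal 0)"
    by (rule measurable_restrict) simp
  show ?thesis
  proof (rule PiM_eqI)
    fix A :: "'a \<Rightarrow> real set" assume A: "\<And>b. b \<in> Basis \<Longrightarrow> A b \<in> sets (normal 0)"
    have "(\<lambda>x::'a. \<lambda>b\<in>Basis. x \<bullet> b) -` Pi\<^sub>E Basis A \<inter> space gauss = {x. \<forall>b\<in>Basis. x \<bullet> b \<in> A b}"
      by (auto simp: PiE_iff)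
    then show "emeasure (distr gauss (\<Pi>\<^sub>M b\<in>Basis. normal 0) (\<lambda>x. \<lambda>b\<in>Basis. x \<bullet> b)) (Pi\<^sub>E Basis A) =
        (\<Prod>b\<in>Basis. emeasure (normal 0) (A b))"
      using A by (subst emeasure_distr) (auto intro!: sets_PiM_I_finite emeasure_gauss_box)
  qed auto
qed

lemma prob_space_gauss: "prob_space gauss"
proof
  show "emeasure gauss (space gauss :: 'a set) = 1"
    using emeasure_gauss_box[where 'a = 'a, of "\<lambda>_. UNIV"] prob_space.emeasure_space_1[OF prob_space_normal[of 0]]
    by simp
qed

text \<open>Squared norms add on a product space, so two independent Gaussian vectors are one
  Gaussian vector there. This makes orthogonal maps that mix the two vectors available.\<close>

lemma gauss_pair: "gauss \<Otimes>\<^sub>M gauss = (gauss :: ('a::euclidean_space \<times> 'b::euclidean_space) measure)"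
proof -
  let ?d = "\<lambda>x::'a. ennreal ((1 / sqrt (2 * pi)) ^ DIM('a) * exp (- (norm x)\<^sup>2 / 2))"
  let ?e = "\<lambda>x::'b. ennreal ((1 / sqrt (2 * pi)) ^ DIM('b) * exp (- (norm x)\<^sup>2 / 2))"
  have sf: "sigma_finite_measure (density lborel ?e)"
    using prob_space_imp_sigma_finite[OF prob_space_gauss[where 'a = 'b]]
    unfolding gauss_def .
  have "gauss \<Otimes>\<^sub>M gauss = density (lborel \<Otimes>\<^sub>M lborel) (\<lambda>(x, y). ?d x * ?e y)"
    unfolding gauss_def
    by (rule pair_measure_density[OF _ _ lborel.sigma_finite_measure_axioms sf]) measurable
  also have "(\<lambda>(x, y). ?d x * ?e y) = (\<lambda>p. ennreal ((1 / sqrt (2 * pi)) ^ DIM('a \<times> 'b) * exp (- (norm p)\<^sup>2 / 2)))"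
  proof (rule ext, clarify)
    fix x :: 'a and y :: 'b
    let ?q = "1 / sqrt (2 * pi)"
    have "exp (- (norm x)\<^sup>2 / 2) * exp (- (norm y)\<^sup>2 / 2) = exp (- (norm (x, y))\<^sup>2 / 2)"
      by (simp add: norm_Pair exp_add[symmetric] add_divide_distrib)
    then have "(?q ^ DIM('a) * exp (- (norm x)\<^sup>2 / 2)) * (?q ^ DIM('b) * exp (- (norm y)\<^sup>2 / 2)) =
        ?q ^ DIM('a \<times> 'b) * exp (- (norm (x, y))\<^sup>2 / 2)"
      by (simp add: power_add mult_ac)
    then show "?d x * ?e y = ennreal (?q ^ DIM('a \<times> 'b) * exp (- (norm (x, y))\<^sup>2 / 2))"
      by (subst ennreal_mult[symmetric]) simp_all
  qed
  finally show ?thesis unfolding gauss_def lborel_prod .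
qed

text \<open>Given the other coordinates, \<open>T w\<close> is a fixed orthogonal map, which
  preserves the law of the pair at \<open>i\<close> and \<open>j\<close>. Every equality in law
  between the stages below is an instance.\<close>

lemma PiM_gauss_rotation:
  fixes T :: "('i \<Rightarrow> 'a::euclidean_space) \<Rightarrow> 'a \<times> 'a \<Rightarrow> 'a \<times> 'a"
  assumes I: "finite I" "i \<in> I" "j \<in> I" "i \<noteq> j"
    and T: "\<And>w. orthogonal_transformation (T w)"
    and dep: "\<And>w x y. T (w(i := x, j := y)) = T w"
    and meas[measurable]: "(\<lambda>w. T w (w i, w j)) \<in> borel_measurable (\<Pi>\<^sub>M i\<in>I. gauss)"
    and f[measurable]: "f \<in> (\<Pi>\<^sub>M i\<in>I. gauss) \<rightarrow>\<^sub>M N"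
  shows "distr (\<Pi>\<^sub>M i\<in>I. gauss) N (\<lambda>w. f (w(i := fst (T w (w i, w j)), j := snd (T w (w i, w j))))) =
    distr (\<Pi>\<^sub>M i\<in>I. gauss) N f"
proof (rule measure_eqI)
  let ?P = "\<Pi>\<^sub>M i\<in>I. gauss :: 'a measure"
  let ?F = "\<lambda>w. w(i := fst (T w (w i, w j)), j := snd (T w (w i, w j)))"
  define J where "J = I - {i, j}"
  have J: "finite J" "i \<notin> J" "j \<notin> J" and IJ: "I = insert i (insert j J)"
    using I by (auto simp: J_def)
  interpret product_sigma_finite "\<lambda>_::'i. gauss :: 'a measure"
    by (intro product_sigma_finite.intro prob_space_imp_sigma_finite prob_space_gauss)
  interpret pair_sigma_finite "gauss :: 'a measure" "gauss :: 'a measure"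
    by standard
  have [measurable]: "?F \<in> ?P \<rightarrow>\<^sub>M ?P"
  proof -
    have fst_m: "(\<lambda>w. fst (T w (w i, w j))) \<in> borel_measurable ?P"
      and snd_m: "(\<lambda>w. snd (T w (w i, w j))) \<in> borel_measurable ?P"
      using meas unfolding borel_prod[symmetric] by measurable
    have 1: "(\<lambda>w. w(i := fst (T w (w i, w j)))) \<in> ?P \<rightarrow>\<^sub>M ?P"
      using I fst_m
      by (intro measurable_fun_upd[where J = I]) (auto simp: measurable_cong_sets[OF refl sets_gauss])
    show ?thesis
      by (rule measurable_fun_upd[where J = I, OF _ 1])
        (use I snd_m in \<open>auto simp: measurable_cong_sets[OF refl sets_gauss]\<close>)
  qed
  \<comment> \<open>Fubini with the pair at \<open>i\<close>, \<open>j\<close> as the inner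
    variable; in the outer integral \<open>w\<close> carries only the coordinates in
    \<open>J\<close>.\<close>
  have split: "(\<integral>\<^sup>+w. h w \<partial>?P) =
      (\<integral>\<^sup>+w. (\<integral>\<^sup>+p. h (w(i := fst p, j := snd p)) \<partial>gauss) \<partial>(\<Pi>\<^sub>M i\<in>J. gauss))"
    if h[measurable]: "h \<in> borel_measurable ?P" for h
  proof -
    have h': "h \<in> borel_measurable (Pi\<^sub>M (insert i (insert j J)) (\<lambda>_. gauss))"
      using h by (simp add: IJ)
    have hc: "(\<lambda>p. h (w(j := snd p, i := fst p))) \<in> borel_measurable (gauss \<Otimes>\<^sub>M gauss)"
      if w: "w \<in> space (\<Pi>\<^sub>M i\<in>J. gauss)" for w
    proof (rule measurable_compose[OF _ h'])
      have "(\<lambda>p. w(j := snd p)) \<in> gauss \<Otimes>\<^sub>M gauss \<rightarrow>\<^sub>M (\<Pi>\<^sub>M i\<in>insert j J. gauss)"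
        using w by (intro measurable_fun_upd[where J = J]) auto
      from measurable_fun_upd[OF _ this, of "insert i (insert j J)" i fst]
      show "(\<lambda>p. w(j := snd p, i := fst p)) \<in> gauss \<Otimes>\<^sub>M gauss \<rightarrow>\<^sub>M (\<Pi>\<^sub>M i\<in>insert i (insert j J). gauss)"
        by simp
    qed
    have "(\<integral>\<^sup>+w. h w \<partial>?P) = (\<integral>\<^sup>+w. (\<integral>\<^sup>+x. h (w(i := x)) \<partial>gauss) \<partial>(\<Pi>\<^sub>M i\<in>insert j J. gauss))"
      unfolding IJ by (rule product_nn_integral_insert) (use J I h' in auto)
    also have "\<dots> = (\<integral>\<^sup>+w. (\<integral>\<^sup>+y. (\<integral>\<^sup>+x. h (w(j := y, i := x)) \<partial>gauss) \<partial>gauss) \<partial>(\<Pi>\<^sub>M i\<in>J. gauss))"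
    proof (rule product_nn_integral_insert)
      have "(\<lambda>(w, x). h (w(i := x))) \<in> borel_measurable ((\<Pi>\<^sub>M i\<in>insert j J. gauss) \<Otimes>\<^sub>M gauss)"
        unfolding case_prod_beta
        by (rule measurable_compose[OF _ h'], rule measurable_fun_upd[where J = "insert j J"]) auto
      then show "(\<lambda>w. \<integral>\<^sup>+x. h (w(i := x)) \<partial>gauss) \<in> borel_measurable (\<Pi>\<^sub>M i\<in>insert j J. gauss)"
        by (rule M.borel_measurable_nn_integral)
    qed (use J in auto)
    also have "\<dots> = (\<integral>\<^sup>+w. (\<integral>\<^sup>+p. h (w(j := snd p, i := fst p)) \<partial>(gauss \<Otimes>\<^sub>M gauss)) \<partial>(\<Pi>\<^sub>M i\<in>J. gauss))"
      by (intro nn_integral_cong, subst nn_integral_snd[symmetric]) (use hc in \<open>auto simp: case_prod_beta\<close>)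
    finally show ?thesis using I by (simp add: gauss_pair fun_upd_twist[of i j])
  qed
  fix X assume X: "X \<in> sets (distr ?P N (\<lambda>w. f (?F w)))"
  then have [measurable]: "X \<in> sets N" by simp
  have "emeasure (distr ?P N (\<lambda>w. f (?F w))) X = (\<integral>\<^sup>+w. indicator X (f (?F w)) \<partial>?P)"
    by (subst nn_integral_indicator[symmetric]) (simp_all add: nn_integral_distr del: nn_integral_indicator)
  \<comment> \<open>By \<open>dep\<close> the updates at \<open>i\<close> and \<open>j\<close>
    disappear from the argument of \<open>T\<close>, so the map is constant in the inner
    integral.\<close>
  also have "\<dots> = (\<integral>\<^sup>+w. (\<integral>\<^sup>+p. indicator X (f (w(i := fst (T w p), j := snd (T w p)))) \<partial>gauss) \<partial>(\<Pi>\<^sub>M i\<in>J. gauss))"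
    by (subst split) (use I in \<open>auto simp: dep\<close>)
  also have "\<dots> = (\<integral>\<^sup>+w. (\<integral>\<^sup>+p. indicator X (f (w(i := fst p, j := snd p))) \<partial>gauss) \<partial>(\<Pi>\<^sub>M i\<in>J. gauss))"
  proof (rule nn_integral_cong)
    fix w assume w: "w \<in> space (\<Pi>\<^sub>M i\<in>J. gauss :: 'a measure)"
    have Tm: "T w \<in> borel_measurable borel"
      using T[of w] by (intro borel_measurable_continuous_onI linear_continuous_on linear_conv_bounded_linear[THEN iffD1])
        (simp add: orthogonal_transformation_def)
    have "(\<lambda>p. w(j := snd p, i := fst p)) \<in> (gauss \<Otimes>\<^sub>M gauss) \<rightarrow>\<^sub>M ?P"
      unfolding IJ
      by (intro measurable_fun_upd[where J = "insert j J"] measurable_fun_upd[where J = J])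
        (use w in auto)
    then have [measurable]: "(\<lambda>p. w(i := fst p, j := snd p)) \<in> borel \<rightarrow>\<^sub>M ?P"
      using I by (simp add: gauss_pair fun_upd_twist[of i j] measurable_cong_sets[OF sets_gauss refl])
    show "(\<integral>\<^sup>+p. indicator X (f (w(i := fst (T w p), j := snd (T w p)))) \<partial>gauss) =
        (\<integral>\<^sup>+p. indicator X (f (w(i := fst p, j := snd p))) \<partial>gauss)"
      using nn_integral_distr[of "T w" gauss borel "\<lambda>p. indicator X (f (w(i := fst p, j := snd p)))"] Tm
      by (simp add: gauss_distr_orthogonal[OF T] measurable_cong_sets[OF sets_gauss refl])
  qed
  also have "\<dots> = (\<integral>\<^sup>+w. indicator X (f w) \<partial>?P)"
    by (rule split[symmetric]) measurable
  also have "\<dots> = emeasure (distr ?P N f) X"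
    by (subst nn_integral_indicator[symmetric]) (simp_all add: nn_integral_distr del: nn_integral_indicator)
  finally show "emeasure (distr ?P N (\<lambda>w. f (?F w))) X = emeasure (distr ?P N f) X" .
qed simp

section \<open>The largest eigenvalue of a Hermitian matrix\<close>

definition cip :: "complex ^ 'm \<Rightarrow> complex ^ 'm \<Rightarrow> complex" where
  "cip x y = (\<Sum>i\<in>UNIV. cnj (x $ i) * y $ i)"

lemma cip_add_right: "cip x (y + z) = cip x y + cip x z"
  and cip_diff_right: "cip x (y - z) = cip x y - cip x z"
  and cip_scale_right: "cip x (c *s y) = c * cip x y"
  and cip_add_left: "cip (x + y) z = cip x z + cip y z"
  and cip_diff_left: "cip (x - y) z = cip x z - cip y z"
  and cip_scale_left: "cip (c *s x) z = cnj c * cip x z"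
  and cip_zero_left: "cip 0 z = 0"
  and cip_zero_right: "cip x 0 = 0"
  by (simp_all add: cip_def algebra_simps sum.distrib sum_subtractf sum_distrib_left)

lemmas cip_simps = cip_add_right cip_diff_right cip_scale_right cip_add_left cip_diff_left
  cip_scale_left cip_zero_left cip_zero_right

lemma cip_sum_right: "cip x (\<Sum>j\<in>J. f j) = (\<Sum>j\<in>J. cip x (f j))"
  by (induction J rule: infinite_finite_induct) (simp_all add: cip_simps)

lemma cip_sum_left: "cip (\<Sum>j\<in>J. f j) x = (\<Sum>j\<in>J. cip (f j) x)"
  by (induction J rule: infinite_finite_induct) (simp_all add: cip_simps)

lemma cnj_cip: "cnj (cip x y) = cip y x"
  by (simp add: cip_def mult.commute)

lemma cip_axis: "cip (axis k 1) x = x $ k"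
  by (simp add: cip_def axis_def if_distrib[of cnj] if_distrib[of "\<lambda>a. a * _"] cong: if_cong)

lemma Re_cip: "Re (cip x y) = x \<bullet> y"
  by (simp add: cip_def inner_vec_def inner_complex_def)

lemma cip_self: "cip x x = of_real ((norm x)\<^sup>2)"
proof (rule complex_eqI)
  show "Im (cip x x) = Im (of_real ((norm x)\<^sup>2))"
    by (simp add: cip_def)
qed (simp add: Re_cip power2_norm_eq_inner)

lemma norm_cvec_scale: "norm (c *s (x :: complex ^ 'm)) = cmod c * norm x"
proof -
  have "complex_of_real ((norm (c *s x))\<^sup>2) = of_real ((cmod c * norm x)\<^sup>2)"
    unfolding power_mult_distrib of_real_mult complex_norm_square cip_self[symmetric] by (simp add: cip_simps)
  then have "(norm (c *s x))\<^sup>2 = (cmod c * norm x)\<^sup>2"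
    unfolding of_real_eq_iff .
  then show ?thesis by simp
qed

lemma scaleR_eq_cvec_scale: "a *\<^sub>R (x :: complex ^ 'm) = complex_of_real a *s x"
  by (simp add: vec_eq_iff) (simp add: scaleR_conv_of_real)

text \<open>Multiplying \<open>y\<close> by a phase makes the product real and nonnegative, and then
  the real Cauchy-Schwarz inequality applies.\<close>

lemma norm_cip_le: "cmod (cip x y) \<le> norm x * norm y"
proof -
  define u where "u = cnj (sgn (cip x y))"
  have "u * cip x y = of_real (cmod (cip x y))"
    using complex_norm_square[of "cip x y"] unfolding u_def sgn_eq
    by (cases "cip x y = 0") (simp_all add: power2_eq_square field_simps)
  then have "cmod (cip x y) = Re (cip x (u *s y))"
    by (simp add: cip_simps)
  also have "\<dots> \<le> norm x * norm (u *s y)"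
    unfolding Re_cip by (rule norm_cauchy_schwarz)
  also have "\<dots> \<le> norm x * norm y"
    by (intro mult_left_mono) (auto simp: norm_cvec_scale u_def norm_sgn)
  finally show ?thesis .
qed

lemma norm_cvec_add_orthogonal:
  assumes "cip x y = 0"
  shows "(norm (x + y))\<^sup>2 = (norm x)\<^sup>2 + (norm y)\<^sup>2"
proof -
  have "x \<bullet> y = 0" using assms Re_cip[of x y] by simp
  then show ?thesis by (simp add: power2_norm_eq_inner inner_simps inner_commute)
qed

lemma outer_mult_vec: "outer x *v y = cip x y *s x"
  by (simp add: vec_eq_iff outer_def matrix_vector_mult_def cip_def sum_distrib_left mult_ac)

lemma sum_matrix_mult_vec:
  fixes M :: "'j \<Rightarrow> complex ^ 'm ^ 'm"
  shows "(\<Sum>j\<in>J. M j) *v y = (\<Sum>j\<in>J. M j *v y)"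
  by (induction J rule: infinite_finite_induct) (simp_all add: matrix_vector_mult_add_rdistrib)

lemma scaleR_matrix_mult_vec:
  fixes M :: "complex ^ 'm ^ 'm"
  shows "(c *\<^sub>R M) *v y = complex_of_real c *s (M *v y)"
  by (simp add: vec_eq_iff matrix_vector_mult_def)
    (simp add: sum_distrib_left scaleR_conv_of_real mult_ac)

text \<open>Stated with the real inner product so that the spectral lemmas for real Euclidean spaces
  apply. Replacing \<open>y\<close> by \<i> times \<open>y\<close> recovers the imaginary part, so
  this is the usual notion.\<close>

definition hermitian :: "complex ^ 'm ^ 'm \<Rightarrow> bool" where
  "hermitian H \<longleftrightarrow> (\<forall>x y. (H *v x) \<bullet> y = x \<bullet> (H *v y))"

lemma hermitian_outer: "hermitian (outer x)"
  unfolding hermitian_def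
proof (intro allI)
  fix y z
  have "cip (outer x *v y) z = cip y (outer x *v z)"
    by (simp add: outer_mult_vec cip_simps cnj_cip)
  then show "(outer x *v y) \<bullet> z = y \<bullet> (outer x *v z)"
    by (metis Re_cip)
qed

lemma hermitian_add: "hermitian A \<Longrightarrow> hermitian B \<Longrightarrow> hermitian (A + B)"
  by (simp add: hermitian_def matrix_vector_mult_add_rdistrib inner_add_left inner_add_right)

lemma hermitian_scaleR: "hermitian A \<Longrightarrow> hermitian (c *\<^sub>R A)"
  by (simp add: hermitian_def scaleR_matrix_mult_vec flip: scaleR_eq_cvec_scale)

lemma hermitian_sum: "(\<And>j. j \<in> J \<Longrightarrow> hermitian (A j)) \<Longrightarrow> hermitian (\<Sum>j\<in>J. A j)"
  by (induction J rule: infinite_finite_induct) (auto simp: hermitian_add, simp_all add: hermitian_def)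

section \<open>Extremal eigenvectors of self-adjoint maps\<close>

lemma linear_matrix_vec: "linear (\<lambda>x. (H :: complex ^ 'm ^ 'm) *v x)"
proof (rule linearI)
  show "H *v (r *\<^sub>R b) = r *\<^sub>R (H *v b)" for r b
    by (simp add: vec_eq_iff matrix_vector_mult_def)
      (simp add: sum_distrib_left scaleR_conv_of_real mult_ac)
qed (rule matrix_vector_right_distrib)

text \<open>The Rayleigh quotient attains its maximum on the compact unit sphere. If the residual
  \<open>f z - l *\<^sub>R z\<close> were nonzero at a maximiser \<open>z\<close>, a small move in
  its direction would increase the quotient to first order.\<close>

lemma selfadjoint_max_eigenvector:
  fixes f :: "'a::euclidean_space \<Rightarrow> 'a"
  assumes lin: "linear f" and sym: "\<And>x y. f x \<bullet> y = x \<bullet> f y"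
  obtains z l where "norm z = 1" "f z = l *\<^sub>R z" "\<And>y. f y \<bullet> y \<le> l * (norm y)\<^sup>2"
proof -
  have cf: "continuous_on S f" for S
    using lin by (simp add: linear_conv_bounded_linear linear_continuous_on)
  have "sphere 0 1 \<noteq> ({} :: 'a set)"
    using SOME_Basis norm_Basis by fastforce
  moreover have "continuous_on (sphere 0 1) (\<lambda>y. f y \<bullet> y)"
    by (intro continuous_intros cf)
  ultimately obtain z where "z \<in> sphere 0 1" and "\<forall>y\<in>sphere 0 1. f y \<bullet> y \<le> f z \<bullet> z"
    using continuous_attains_sup[of "sphere 0 1" "\<lambda>y. f y \<bullet> y"] by auto
  then have z: "norm z = 1" and max: "\<And>y. norm y = 1 \<Longrightarrow> f y \<bullet> y \<le> f z \<bullet> z"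
    by auto
  define l where "l = f z \<bullet> z"
  have le: "f y \<bullet> y \<le> l * (norm y)\<^sup>2" for y
  proof (cases "y = 0")
    case False
    have "f (y /\<^sub>R norm y) \<bullet> (y /\<^sub>R norm y) \<le> l"
      unfolding l_def using False by (intro max) simp
    then have "(f y \<bullet> y) / (norm y)\<^sup>2 \<le> l"
      by (simp add: linear_scale[OF lin] power2_eq_square divide_simps split: if_splits)
    then show ?thesis using False by (simp add: divide_simps)
  qed (simp add: linear_0[OF lin])
  \<comment> \<open>Along \<open>z + t *\<^sub>R y\<close> the nonnegative form l |x|^2 - f x
    \<bullet> x vanishes at \<open>t = 0\<close>; its linear coefficient is \<open>- 2 * q\<close>
    and its quadratic coefficient is \<open>c\<close>.\<close>
  define y where "y = f z - l *\<^sub>R z"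
  define q where "q = y \<bullet> y"
  define c where "c = l * (y \<bullet> y) - f y \<bullet> y"
  have ge: "0 \<le> t * (t * c - 2 * q)" for t
  proof -
    have fzy: "f y \<bullet> z = f z \<bullet> y" using sym[of y z] by (simp add: inner_commute)
    have q: "q = f z \<bullet> y - l * (z \<bullet> y)"
      by (simp add: q_def inner_diff_left[of "f z" "l *\<^sub>R z" y, folded y_def])
    have zz: "z \<bullet> z = 1" using z by (simp add: norm_eq_1)
    have "0 \<le> l * ((z + t *\<^sub>R y) \<bullet> (z + t *\<^sub>R y)) - f (z + t *\<^sub>R y) \<bullet> (z + t *\<^sub>R y)"
      using le[of "z + t *\<^sub>R y"] by (simp add: power2_norm_eq_inner)
    also have "\<dots> = t * (t * c - 2 * q)"
      unfolding q c_def
      by (simp add: linear_add[OF lin] linear_scale[OF lin] inner_simps fzy zz inner_commute[of y z])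
        (simp add: l_def[symmetric] algebra_simps)
    finally show ?thesis .
  qed
  have "q = 0"
  proof (rule ccontr)
    assume "q \<noteq> 0"
    then have q: "q > 0" by (simp add: q_def)
    \<comment> \<open>Small enough that \<open>t * c\<close> is at most \<open>q\<close>, so the
      linear term wins; adding 1 keeps the denominator positive.\<close>
    define t where "t = q / (\<bar>c\<bar> + 1)"
    have t: "t > 0" using q by (simp add: t_def)
    have "t * c \<le> t * (\<bar>c\<bar> + 1)" using t by (intro mult_left_mono) auto
    also have "\<dots> = q" by (simp add: t_def)
    finally have "t * c - 2 * q < 0" using q by simp
    then show False using ge[of t] t by (simp add: zero_le_mult_iff)
  qed
  then have "f z = l *\<^sub>R z" by (simp add: q_def y_def)
  then show ?thesis using that z le by blast
qed

text \<open>Eigenvectors for different eigenvalues are orthogonal, so one chosen eigenvector per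
  eigenvalue gives an independent and hence finite family. The \<open>Max\<close> in
  \<open>largest_eigenvalue\<close> relies on this.\<close>

lemma selfadjoint_finite_eigenvalues:
  fixes f :: "'a::euclidean_space \<Rightarrow> 'a"
  assumes sym: "\<And>x y. f x \<bullet> y = x \<bullet> f y"
  shows "finite {l. \<exists>x. x \<noteq> 0 \<and> f x = l *\<^sub>R x}"
proof -
  let ?E = "{l. \<exists>x. x \<noteq> 0 \<and> f x = l *\<^sub>R x}"
  define e where "e l = (SOME x. x \<noteq> 0 \<and> f x = l *\<^sub>R x)" for l
  have e: "e l \<noteq> 0" "f (e l) = l *\<^sub>R e l" if "l \<in> ?E" for l
    using someI_ex[of "\<lambda>x. x \<noteq> 0 \<and> f x = l *\<^sub>R x"] that unfolding e_def by auto
  have orth: "e l \<bullet> e l' = 0" if "l \<in> ?E" "l' \<in> ?E" "l \<noteq> l'" for l l'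
    using sym[of "e l" "e l'"] e[OF that(1)] e[OF that(2)] that(3) by simp
  have inj: "inj_on e ?E"
  proof (rule inj_onI, rule ccontr)
    fix l l' assume "l \<in> ?E" "l' \<in> ?E" "e l = e l'" "l \<noteq> l'"
    then show False using orth[of l l'] e(1)[of l] by simp
  qed
  have "pairwise orthogonal (e ` ?E)"
    unfolding pairwise_def orthogonal_def using orth by blast
  moreover have "0 \<notin> e ` ?E" using e(1) by force
  ultimately have "independent (e ` ?E)" by (rule pairwise_orthogonal_independent)
  then have "finite (e ` ?E)" by (rule independent_imp_finite)
  then show ?thesis using inj by (simp add: finite_image_iff)
qed

text \<open>Identifies the \<open>Max\<close> with the maximum of the Rayleigh quotient. The last
  clause turns any test vector into a lower bound for the eigenvalue.\<close>

lemma hermitian_largest_eigenvalue: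
  assumes "hermitian H"
  obtains z where "norm z = 1" "H *v z = complex_of_real (largest_eigenvalue H) *s z"
    "\<And>y. (H *v y) \<bullet> y \<le> largest_eigenvalue H * (norm y)\<^sup>2"
proof -
  have sym: "(H *v x) \<bullet> y = x \<bullet> (H *v y)" for x y
    using assms by (simp add: hermitian_def)
  obtain z l where z: "norm z = 1" "H *v z = l *\<^sub>R z" "\<And>y. (H *v y) \<bullet> y \<le> l * (norm y)\<^sup>2"
    using selfadjoint_max_eigenvector[OF linear_matrix_vec sym] by blast
  have "largest_eigenvalue H = l"
    unfolding largest_eigenvalue_def scaleR_eq_cvec_scale[symmetric]
  proof (rule Max_eqI)
    show "finite {l. \<exists>x. x \<noteq> 0 \<and> H *v x = l *\<^sub>R x}"
      by (rule selfadjoint_finite_eigenvalues[OF sym])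
    show "l \<in> {l. \<exists>x. x \<noteq> 0 \<and> H *v x = l *\<^sub>R x}"
      using z by (intro CollectI exI[of _ z]) auto
    fix l' assume "l' \<in> {l. \<exists>x. x \<noteq> 0 \<and> H *v x = l *\<^sub>R x}"
    then obtain x where x: "x \<noteq> 0" "H *v x = l' *\<^sub>R x" by blast
    show "l' \<le> l"
      using z(3)[of x] x by (simp add: power2_norm_eq_inner)
  qed
  then show ?thesis using z that by (simp add: scaleR_eq_cvec_scale)
qed

text \<open>As a supremum of continuous functions of \<open>H\<close>, the largest eigenvalue is lower semicontinuous.\<close>
lemma borel_measurable_largest_eigenvalue:
  fixes H :: "'w \<Rightarrow> complex ^ 'm ^ 'm"
  assumes H: "H \<in> borel_measurable M" and herm: "\<And>w. w \<in> space M \<Longrightarrow> hermitian (H w)"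
  shows "(\<lambda>w. largest_eigenvalue (H w)) \<in> borel_measurable M"
  unfolding borel_measurable_iff_greater
proof
  fix c :: real
  define U :: "(complex ^ 'm ^ 'm) set" where "U = (\<Union>x\<in>sphere 0 1. {G. c < (G *v x) \<bullet> x})"
  have "open {G :: complex ^ 'm ^ 'm. c < (G *v x) \<bullet> x}" for x
    unfolding matrix_vector_mult_def inner_vec_def
    by (intro open_Collect_less continuous_intros)
  then have "open U" by (auto simp: U_def)
  then have "H -` U \<inter> space M \<in> sets M"
    using H by (intro measurable_sets[where A = borel]) auto
  moreover have "H -` U \<inter> space M = {w \<in> space M. c < largest_eigenvalue (H w)}"
  proof (intro set_eqI iffI)
    fix w assume "w \<in> H -` U \<inter> space M"
    then obtain x where w: "w \<in> space M" and x: "norm x = 1" "c < (H w *v x) \<bullet> x" by (auto simp: U_def)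
    then show "w \<in> {w \<in> space M. c < largest_eigenvalue (H w)}"
    proof -
      have "(H w *v x) \<bullet> x \<le> largest_eigenvalue (H w) * (norm x)\<^sup>2"
        by (rule hermitian_largest_eigenvalue[OF herm[OF w]])
      then show ?thesis using w x by simp
    qed
  next
    fix w assume "w \<in> {w \<in> space M. c < largest_eigenvalue (H w)}"
    then have w: "w \<in> space M" and c: "c < largest_eigenvalue (H w)" by auto
    obtain z where z: "norm z = 1" "H w *v z = complex_of_real (largest_eigenvalue (H w)) *s z"
      using hermitian_largest_eigenvalue[OF herm[OF w]] by blast
    then have "(H w *v z) \<bullet> z = largest_eigenvalue (H w)"
      by (simp add: norm_eq_1 flip: scaleR_eq_cvec_scale)
    then show "w \<in> H -` U \<inter> space M"
      using w c z(1) by (auto simp: U_def intro!: bexI[of _ z])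
  qed
  ultimately show "{w \<in> space M. c < largest_eigenvalue (H w)} \<in> sets M" by simp
qed

text \<open>
  If \<open>x\<close> is an eigenvector for \<open>l\<close> scaled to \<open>cip z x = 1\<close>, then \<open>l x = z + s\<^sup>2 K x\<close> with
  \<open>K = (\<Sum>j\<in>J. outer (d j))\<close>, and inserting this equation into itself twice gives
  \<open>l = |z|\<^sup>2 + s\<^sup>4 Q / l\<close> up to the error \<open>s\<^sup>4 cip (K z) (K x) / l\<close>.
\<close>
lemma largest_eigenvalue_perturbation:
  fixes v b :: "complex ^ 'm" and d :: "'j \<Rightarrow> complex ^ 'm" and J :: "'j set" and \<alpha> :: complex and s :: real
  assumes v: "norm v = 1" and s: "s > 0" and \<alpha>: "\<alpha> \<noteq> 0"
    and vb: "cip v b = 0" and vd: "\<And>j. j \<in> J \<Longrightarrow> cip v (d j) = 0"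
  defines "\<kappa> \<equiv> \<Sum>j\<in>J. (norm (d j))\<^sup>2" and "Q \<equiv> \<Sum>j\<in>J. (cmod (cip (d j) b))\<^sup>2"
  defines "p \<equiv> (cmod \<alpha>)\<^sup>2" and "\<beta> \<equiv> (norm b)\<^sup>2"
  defines "z \<equiv> \<alpha> *s v + complex_of_real s *s b"
  defines "l \<equiv> largest_eigenvalue (outer z + s\<^sup>2 *\<^sub>R (\<Sum>j\<in>J. outer (d j)))"
  assumes small: "2 * s\<^sup>2 * \<kappa> \<le> p"
  shows "\<bar>l - (p + s\<^sup>2 * \<beta> + s ^ 4 * Q / p)\<bar> \<le> 2 * s ^ 6 * \<kappa> * \<beta> * (\<kappa> + \<beta>) / p\<^sup>2"
proof -
  let ?H = "outer z + s\<^sup>2 *\<^sub>R (\<Sum>j\<in>J. outer (d j))"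
  define K where "K x = (\<Sum>j\<in>J. cip (d j) x *s d j)" for x
  have H: "?H *v x = cip z x *s z + complex_of_real (s\<^sup>2) *s K x" for x
    by (simp add: matrix_vector_mult_add_rdistrib scaleR_matrix_mult_vec sum_matrix_mult_vec outer_mult_vec K_def)
  have K_scale: "K (c *s x) = c *s K x" for c x
    unfolding K_def vec.scale_sum_right by (simp add: cip_simps)
  have K_adj: "cip x (K y) = cip (K x) y" for x y
    by (simp add: K_def cip_sum_right cip_sum_left cip_simps cnj_cip mult.commute)
  have K_le: "norm (K x) \<le> \<kappa> * norm x" for x
  proof -
    have "norm (K x) \<le> (\<Sum>j\<in>J. norm (cip (d j) x *s d j))"
      unfolding K_def by (rule norm_sum)
    also have "\<dots> \<le> (\<Sum>j\<in>J. (norm (d j))\<^sup>2 * norm x)"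
    proof (rule sum_mono)
      fix j
      show "norm (cip (d j) x *s d j) \<le> (norm (d j))\<^sup>2 * norm x"
        using mult_right_mono[OF norm_cip_le[of "d j" x], of "norm (d j)"]
        by (simp add: norm_cvec_scale power2_eq_square mult_ac)
    qed
    finally show ?thesis by (simp add: \<kappa>_def sum_distrib_right)
  qed
  have s6: "s ^ 6 = s ^ 4 * s\<^sup>2" by (simp flip: power_add)
  have \<kappa>: "\<kappa> \<ge> 0" and \<beta>: "\<beta> \<ge> 0" and p: "p > 0" and Q: "Q \<ge> 0"
    using \<alpha> by (simp_all add: \<kappa>_def \<beta>_def p_def Q_def sum_nonneg)
  have Q_le: "Q \<le> \<kappa> * \<beta>"
    unfolding Q_def \<kappa>_def \<beta>_def sum_distrib_right power_mult_distrib[symmetric]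
    by (intro sum_mono power_mono norm_cip_le) simp
  define a where "a = p + s\<^sup>2 * \<beta>"
  have z_norm: "(norm z)\<^sup>2 = a"
    using norm_cvec_add_orthogonal[of "\<alpha> *s v" "complex_of_real s *s b"] v s
    by (simp add: z_def cip_simps vb norm_cvec_scale a_def p_def \<beta>_def power_mult_distrib)
  have dz: "cip (d j) z = complex_of_real s * cip (d j) b" if "j \<in> J" for j
    using vd[OF that] cnj_cip[of v "d j"] by (simp add: z_def cip_simps)
  have Kz: "K z = complex_of_real s *s K b"
    unfolding K_scale[symmetric] unfolding K_def by (intro sum.cong refl) (simp add: dz cip_simps)
  have Kzz: "cip (K z) z = complex_of_real (s\<^sup>2 * Q)"
  proof -
    have "cip (K z) z = (\<Sum>j\<in>J. cnj (cip (d j) z) * cip (d j) z)"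
      by (simp add: K_def cip_sum_left cip_simps)
    also have "\<dots> = (\<Sum>j\<in>J. complex_of_real (s\<^sup>2 * (cmod (cip (d j) b))\<^sup>2))"
    proof (rule sum.cong)
      fix j assume "j \<in> J"
      then show "cnj (cip (d j) z) * cip (d j) z = complex_of_real (s\<^sup>2 * (cmod (cip (d j) b))\<^sup>2)"
        unfolding dz[OF \<open>j \<in> J\<close>] of_real_mult complex_norm_square by (simp add: power2_eq_square)
    qed simp
    finally show ?thesis by (simp add: Q_def sum_distrib_left)
  qed
  have Kz_le: "norm (K z) \<le> s * \<kappa> * norm b"
    using K_le[of b] s by (simp add: Kz norm_cvec_scale mult.assoc)
  have "hermitian ?H"
    by (intro hermitian_add hermitian_scaleR hermitian_sum hermitian_outer)
  then obtain x where x: "norm x = 1" and eig: "?H *v x = complex_of_real l *s x"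
    and ray: "\<And>y. (?H *v y) \<bullet> y \<le> l * (norm y)\<^sup>2"
    using hermitian_largest_eigenvalue[of ?H, folded l_def] by blast
  have ap: "a \<ge> p" using \<beta> by (simp add: a_def)
  \<comment> \<open>With \<open>z\<close> as test vector the Rayleigh quotient is (a^2 + s^4 Q) / a,
    which is at least \<open>a\<close>.\<close>
  have la: "l \<ge> a"
  proof -
    have "(?H *v z) \<bullet> z = Re (cip (?H *v z) z)" by (simp add: Re_cip)
    also have "\<dots> = a * a + s\<^sup>2 * (s\<^sup>2 * Q)"
      by (simp add: H cip_simps Kzz cip_self z_norm)
    finally have "a * a \<le> (?H *v z) \<bullet> z" using Q by simp
    also have "\<dots> \<le> l * a" using ray[of z] by (simp add: z_norm)
    finally show ?thesis using ap p by simp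
  qed
  have lp: "l \<ge> p" and l: "l > 0" using la ap p by auto
  have sk: "s\<^sup>2 * \<kappa> \<le> p / 2" using small by simp
  define t where "t = cip z x"
  \<comment> \<open>Otherwise \<open>x\<close> would be an eigenvector of s^2 K for
    \<open>l\<close>; but s^2 K has norm at most \<open>p / 2\<close>, by \<open>small\<close>,
    while \<open>l\<close> is at least \<open>p\<close>.\<close>
  have "t \<noteq> 0"
  proof
    assume "t = 0"
    then have "complex_of_real l *s x = complex_of_real (s\<^sup>2) *s K x"
      using eig by (simp add: H t_def)
    then have "norm (complex_of_real l *s x) = norm (complex_of_real (s\<^sup>2) *s K x)" by simp
    then have "l = s\<^sup>2 * norm (K x)" using l x by (simp add: norm_cvec_scale norm_power)
    also have "\<dots> \<le> s\<^sup>2 * \<kappa>" using K_le[of x] x by (intro mult_left_mono) auto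
    finally show False using lp sk p by simp
  qed
  define y where "y = (1 / t) *s x"
  have zy: "cip z y = 1" using \<open>t \<noteq> 0\<close> by (simp add: y_def cip_simps t_def)
  have y: "complex_of_real l *s y = z + complex_of_real (s\<^sup>2) *s K y"
  proof -
    have "complex_of_real l *s y = (1 / t) *s (complex_of_real l *s x)"
      by (simp add: y_def mult_ac)
    also have "\<dots> = (1 / t) *s (t *s z + complex_of_real (s\<^sup>2) *s K x)"
      by (simp only: eig[symmetric] H t_def)
    also have "\<dots> = z + complex_of_real (s\<^sup>2) *s K y"
      using \<open>t \<noteq> 0\<close> by (simp add: vec.scale_right_distrib K_scale y_def mult_ac)
    finally show ?thesis .
  qed
  \<comment> \<open>Pair the equation for \<open>y\<close> with \<open>z\<close>, then with
    \<open>K z\<close>, moving \<open>K\<close> across by self-adjointness. The unknown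
    \<open>cip (K z) y\<close> is then eliminated between the two.\<close>
  have eq1: "complex_of_real l = complex_of_real a + complex_of_real (s\<^sup>2) * cip (K z) y"
    using arg_cong[OF y, of "cip z"] zy by (simp add: cip_simps cip_self z_norm K_adj)
  have eq2: "complex_of_real l * cip (K z) y = complex_of_real (s\<^sup>2 * Q) + complex_of_real (s\<^sup>2) * cip (K z) (K y)"
    using arg_cong[OF y, of "cip (K z)"] by (simp add: cip_simps Kzz)
  define \<epsilon> where "\<epsilon> = l - a - s ^ 4 * Q / l"
  have "complex_of_real \<epsilon> * complex_of_real l = complex_of_real (s ^ 4) * cip (K z) (K y)"
  proof -
    have "complex_of_real \<epsilon> * complex_of_real l =
        (complex_of_real l - complex_of_real a) * complex_of_real l - complex_of_real (s ^ 4 * Q)"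
      unfolding of_real_diff[symmetric] of_real_mult[symmetric]
      using l by (simp add: \<epsilon>_def field_simps)
    also have "complex_of_real l - complex_of_real a = complex_of_real (s\<^sup>2) * cip (K z) y"
      using eq1 by simp
    also have "\<dots> * complex_of_real l = complex_of_real (s\<^sup>2) * (complex_of_real l * cip (K z) y)"
      by simp
    finally show ?thesis
      unfolding eq2 by (simp add: algebra_simps power2_eq_square power4_eq_xxxx)
  qed
  from arg_cong[OF this, of cmod]
  have \<epsilon>eq: "\<bar>\<epsilon>\<bar> * l = s ^ 4 * cmod (cip (K z) (K y))"
    using l s by (simp add: norm_mult norm_power)
  \<comment> \<open>Apply \<open>K\<close> to the equation for \<open>y\<close>. The term with
    \<open>K (K y)\<close> has norm at most \<open>p / 2 * norm (K y)\<close> and is absorbed on the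
    left, where the factor is \<open>l\<close>, at least \<open>p\<close>.\<close>
  have Ky: "norm (K y) \<le> 2 * norm (K z) / p"
  proof -
    have KK: "K (u + w) = K u + K w" for u w
      by (simp add: K_def cip_simps vec.scale_left_distrib sum.distrib)
    have "l * norm (K y) = norm (K (complex_of_real l *s y))"
      using l by (simp add: K_scale norm_cvec_scale)
    also have "\<dots> = norm (K z + complex_of_real (s\<^sup>2) *s K (K y))"
      by (simp only: y KK K_scale)
    also have "\<dots> \<le> norm (K z) + s\<^sup>2 * norm (K (K y))"
      using norm_triangle_ineq[of "K z" "complex_of_real (s\<^sup>2) *s K (K y)"]
      by (simp add: norm_cvec_scale norm_power)
    also have "\<dots> \<le> norm (K z) + s\<^sup>2 * (\<kappa> * norm (K y))"
      by (intro add_left_mono mult_left_mono K_le) simp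
    also have "\<dots> \<le> norm (K z) + p / 2 * norm (K y)"
      using mult_right_mono[OF sk, of "norm (K y)"] by (simp add: mult.assoc)
    finally have "l * norm (K y) \<le> norm (K z) + p / 2 * norm (K y)" .
    moreover have "p * norm (K y) \<le> l * norm (K y)" using lp by (intro mult_right_mono) auto
    ultimately have "p * norm (K y) \<le> 2 * norm (K z)" by simp
    then show ?thesis using p by (simp add: field_simps)
  qed
  \<comment> \<open>Both factors of the product are controlled by \<open>norm (K z)\<close>, and
    \<open>K z\<close> is \<open>s\<close> times \<open>K b\<close> because the \<open>d j\<close>
    are orthogonal to \<open>v\<close>. This raises the order from s^4 to s^6.\<close>
  have \<epsilon>_le: "\<bar>\<epsilon>\<bar> \<le> 2 * s ^ 6 * \<kappa>\<^sup>2 * \<beta> / p\<^sup>2"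
  proof -
    have "\<bar>\<epsilon>\<bar> * p \<le> \<bar>\<epsilon>\<bar> * l" using lp by (intro mult_left_mono) auto
    also have "\<dots> \<le> s ^ 4 * (norm (K z) * norm (K y))"
      unfolding \<epsilon>eq by (intro mult_left_mono norm_cip_le) simp
    also have "\<dots> \<le> s ^ 4 * (norm (K z) * (2 * norm (K z) / p))"
      by (intro mult_left_mono Ky) simp_all
    also have "\<dots> = 2 * s ^ 4 * (norm (K z))\<^sup>2 / p"
      by (simp add: power2_eq_square)
    also have "\<dots> \<le> 2 * s ^ 4 * (s * \<kappa> * norm b)\<^sup>2 / p"
      using p by (intro divide_right_mono mult_left_mono power_mono Kz_le) auto
    also have "\<dots> = 2 * s ^ 6 * \<kappa>\<^sup>2 * \<beta> / p"
      unfolding s6 \<beta>_def power_mult_distrib by (simp only: mult_ac)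
    finally have "\<bar>\<epsilon>\<bar> \<le> 2 * s ^ 6 * \<kappa>\<^sup>2 * \<beta> / p / p" using p by (simp add: pos_le_divide_eq)
    then show ?thesis by (simp add: power2_eq_square)
  qed
  \<comment> \<open>A crude bound, to exchange \<open>l\<close> for \<open>p\<close> in the
    denominator of \<open>Q\<close>. In l - p = s^2 \<beta> + s^4 Q / l + \<epsilon> each of the
    last two terms is at most s^2 \<beta> / 2, by \<open>small\<close>.\<close>
  have diff: "l - p \<le> 2 * s\<^sup>2 * \<beta>"
  proof -
    have "s ^ 4 * Q / l \<le> s ^ 4 * Q / p"
      using lp p Q by (intro divide_left_mono) (auto intro!: mult_pos_pos l)
    also have "\<dots> \<le> s ^ 4 * (\<kappa> * \<beta>) / p"
      using p Q_le by (intro divide_right_mono mult_left_mono) auto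
    also have "\<dots> = (s\<^sup>2 * \<kappa>) * (s\<^sup>2 * \<beta>) / p"
      by (simp add: power2_eq_square power4_eq_xxxx)
    also have "\<dots> \<le> (p / 2) * (s\<^sup>2 * \<beta>) / p"
      using p \<beta> by (intro divide_right_mono mult_right_mono sk) auto
    finally have 1: "s ^ 4 * Q / l \<le> s\<^sup>2 * \<beta> / 2" using p by simp
    have "2 * s ^ 6 * \<kappa>\<^sup>2 * \<beta> / p\<^sup>2 = 2 * (s\<^sup>2 * \<kappa>)\<^sup>2 * (s\<^sup>2 * \<beta>) / p\<^sup>2"
      by (simp add: power_mult_distrib mult_ac flip: power_mult)
    also have "\<dots> \<le> 2 * (p / 2)\<^sup>2 * (s\<^sup>2 * \<beta>) / p\<^sup>2"
      using \<kappa> \<beta> by (intro divide_right_mono mult_right_mono mult_left_mono power_mono sk) auto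
    also have "\<dots> = s\<^sup>2 * \<beta> / 2" using p by (simp add: power2_eq_square)
    finally have 2: "\<epsilon> \<le> s\<^sup>2 * \<beta> / 2" using \<epsilon>_le by linarith
    show ?thesis using 1 2 unfolding \<epsilon>_def a_def by linarith
  qed
  have "s ^ 4 * Q / p - s ^ 4 * Q / l = s ^ 4 * Q * (l - p) / (l * p)"
    using l p by (simp add: field_simps)
  also have "\<dots> \<le> s ^ 4 * (\<kappa> * \<beta>) * (2 * s\<^sup>2 * \<beta>) / (p * p)"
    using lp p l diff Q_le Q \<kappa> \<beta> by (intro frac_le mult_mono) (auto intro!: mult_nonneg_nonneg)
  also have "\<dots> = 2 * s ^ 6 * \<kappa> * \<beta>\<^sup>2 / p\<^sup>2"
    unfolding s6 power2_eq_square[of \<beta>] power2_eq_square[of p] by (simp only: mult_ac)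
  finally have up: "s ^ 4 * Q / p - s ^ 4 * Q / l \<le> 2 * s ^ 6 * \<kappa> * \<beta>\<^sup>2 / p\<^sup>2" .
  have lo: "s ^ 4 * Q / l \<le> s ^ 4 * Q / p"
    using lp p Q l by (intro divide_left_mono) auto
  have aux: "\<bar>l - (a + y)\<bar> \<le> e + f" if "\<bar>l - a - x\<bar> \<le> e" "y - x \<le> f" "x \<le> y" for x y e f :: real
    using that by linarith
  have "\<bar>l - (p + s\<^sup>2 * \<beta> + s ^ 4 * Q / p)\<bar> \<le> 2 * s ^ 6 * \<kappa>\<^sup>2 * \<beta> / p\<^sup>2 + 2 * s ^ 6 * \<kappa> * \<beta>\<^sup>2 / p\<^sup>2"
    using aux[OF \<epsilon>_le[unfolded \<epsilon>_def] up lo] unfolding a_def .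
  also have "\<dots> = 2 * s ^ 6 * \<kappa> * \<beta> * (\<kappa> + \<beta>) / p\<^sup>2"
    by (simp only: distrib_left distrib_right add_divide_distrib power2_eq_square mult_ac)
  finally show ?thesis .
qed

section \<open>Complex normal and chi-squared laws\<close>

lemma mat_mult_vec: "mat c *v x = c *s (x :: complex ^ 'm)"
  by (simp add: vec_eq_iff matrix_vector_mult_def mat_def if_distrib[of "\<lambda>a. a * _"] cong: if_cong)

lemma mat_mult_mat: "mat a ** mat b = (mat (a * b) :: complex ^ 'm ^ 'm)"
  by (simp add: matrix_eq mat_mult_vec flip: matrix_vector_mul_assoc)

lemma matrix_inv_mat:
  assumes "c \<noteq> 0"
  shows "matrix_inv (mat c :: complex ^ 'm ^ 'm) = mat (1 / c)"
proof -
  let ?P = "\<lambda>A'. (mat c :: complex ^ 'm ^ 'm) ** A' = mat 1 \<and> A' ** mat c = mat 1"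
  have "?P (mat (1 / c))" using assms by (simp add: mat_mult_mat)
  then have "?P (matrix_inv (mat c))" unfolding matrix_inv_def by (rule someI)
  then have "mat (1 / c) ** (mat c ** matrix_inv (mat c :: complex ^ 'm ^ 'm)) = mat (1 / c)"
    by simp
  then show ?thesis
    unfolding matrix_mul_assoc mat_mult_mat using assms by simp
qed

text \<open>The variance \<sigma>^2 of a complex coordinate is shared equally by its real and
  imaginary parts, whence the factor \<sigma> / sqrt 2. The proof is the change of variables
  formula.\<close>

lemma complex_normal_affine:
  fixes \<mu> :: "complex ^ 'm" and \<sigma> :: real
  assumes \<sigma>: "\<sigma> > 0"
  shows "complex_normal \<mu> (mat (complex_of_real (\<sigma>\<^sup>2))) =
    distr gauss borel (\<lambda>x. \<mu> + (\<sigma> / sqrt 2) *\<^sub>R x)"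
proof -
  let ?m = "CARD('m)" and ?s = "\<sigma> / sqrt 2"
  let ?T = "\<lambda>x::complex ^ 'm. \<mu> + ?s *\<^sub>R x"
  define f where "f x = ennreal (exp (- ((norm (x - \<mu>))\<^sup>2 / \<sigma>\<^sup>2)) / (pi * \<sigma>\<^sup>2) ^ ?m)" for x
  have [measurable]: "f \<in> borel_measurable borel" "?T \<in> borel_measurable borel"
    unfolding f_def by measurable
  have c: "complex_of_real (\<sigma>\<^sup>2) \<noteq> 0" using \<sigma> by simp
  have "det (mat (complex_of_real (\<sigma>\<^sup>2)) :: complex ^ 'm ^ 'm) = complex_of_real ((\<sigma>\<^sup>2) ^ ?m)"
    by (subst det_diagonal) (simp_all add: mat_def)
  then have det: "Re (det (mat (complex_of_real (\<sigma>\<^sup>2)) :: complex ^ 'm ^ 'm)) = (\<sigma>\<^sup>2) ^ ?m"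
    by simp
  have quad: "(\<Sum>i\<in>UNIV. cnj (y $ i) * (matrix_inv (mat (complex_of_real (\<sigma>\<^sup>2))) *v y) $ i) =
      complex_of_real ((norm y)\<^sup>2 / \<sigma>\<^sup>2)" for y :: "complex ^ 'm"
  proof -
    have "(\<Sum>i\<in>UNIV. cnj (y $ i) * (matrix_inv (mat (complex_of_real (\<sigma>\<^sup>2))) *v y) $ i) =
        cip y ((1 / complex_of_real (\<sigma>\<^sup>2)) *s y)"
      unfolding matrix_inv_mat[OF c] mat_mult_vec cip_def ..
    then show ?thesis by (simp add: cip_simps cip_self)
  qed
  have "complex_normal \<mu> (mat (complex_of_real (\<sigma>\<^sup>2))) = density lborel f"
    unfolding complex_normal_def det quad f_def by (simp add: power_mult_distrib)
  also have "\<dots> = density (density (distr lborel borel ?T) (\<lambda>_. ennreal (\<bar>?s\<bar> ^ DIM(complex ^ 'm)))) f"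
    using \<sigma> by (subst lborel_affine[of ?s \<mu>]) (simp_all add: ennreal_power)
  also have "\<dots> = density (distr lborel borel ?T) (\<lambda>x. ennreal (\<bar>?s\<bar> ^ DIM(complex ^ 'm)) * f x)"
    by (rule density_density_eq) measurable
  also have "\<dots> = distr (density lborel (\<lambda>x. ennreal (\<bar>?s\<bar> ^ DIM(complex ^ 'm)) * f (?T x))) borel ?T"
    by (rule density_distr) measurable
  also have "(\<lambda>x. ennreal (\<bar>?s\<bar> ^ DIM(complex ^ 'm)) * f (?T x)) =
      (\<lambda>x. ennreal ((1 / sqrt (2 * pi)) ^ DIM(complex ^ 'm) * exp (- (norm x)\<^sup>2 / 2)))"
  proof
    fix x :: "complex ^ 'm"
    have "(norm (?s *\<^sub>R x))\<^sup>2 / \<sigma>\<^sup>2 = (norm x)\<^sup>2 / 2"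
      using \<sigma> by (simp add: power_mult_distrib power_divide)
    then have fT: "f (?T x) = ennreal (exp (- (norm x)\<^sup>2 / 2) / (pi * \<sigma>\<^sup>2) ^ ?m)"
      by (simp add: f_def)
    \<comment> \<open>The real dimension is twice \<open>?m\<close>, so the Jacobian is a power of
      \<sigma>^2 / 2 and cancels \<sigma> from the normalisation.\<close>
    have 1: "\<bar>?s\<bar> ^ DIM(complex ^ 'm) = (\<sigma>\<^sup>2 / 2) ^ ?m"
      using \<sigma> by (simp add: power_mult mult.commute[of ?m 2] power_divide)
    have 2: "(1 / sqrt (2 * pi)) ^ DIM(complex ^ 'm) = (1 / (2 * pi)) ^ ?m"
      by (simp add: power_mult mult.commute[of ?m 2] power_divide)
    have 3: "(\<sigma>\<^sup>2 / 2) ^ ?m / (pi * \<sigma>\<^sup>2) ^ ?m = (1 / (2 * pi)) ^ ?m"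
      unfolding power_divide[symmetric] using \<sigma> by simp
    have "\<bar>?s\<bar> ^ DIM(complex ^ 'm) * (exp (- (norm x)\<^sup>2 / 2) / (pi * \<sigma>\<^sup>2) ^ ?m) =
        (1 / sqrt (2 * pi)) ^ DIM(complex ^ 'm) * exp (- (norm x)\<^sup>2 / 2)"
      unfolding 1 2 3[symmetric] by simp
    then show "ennreal (\<bar>?s\<bar> ^ DIM(complex ^ 'm)) * f (?T x) =
        ennreal ((1 / sqrt (2 * pi)) ^ DIM(complex ^ 'm) * exp (- (norm x)\<^sup>2 / 2))"
      unfolding fT by (subst ennreal_mult[symmetric]) simp_all
  qed
  finally show ?thesis unfolding gauss_def .
qed

section \<open>Chi-squared laws from Gaussian coordinates\<close>

lemma normal_shift: "distr (normal 0) borel ((+) a) = normal a"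
proof -
  have "normal a = density (distr lborel borel ((+) a)) (\<lambda>x. ennreal (normal_density a 1 x))"
    by (simp add: lborel_distr_plus)
  also have "\<dots> = distr (density lborel (\<lambda>x. ennreal (normal_density a 1 (a + x)))) borel ((+) a)"
    by (rule density_distr) measurable
  finally show ?thesis by (simp add: normal_density_def)
qed

lemma emeasure_normal_shift:
  "A \<in> sets borel \<Longrightarrow> emeasure (normal a) A = emeasure (normal 0) ((+) a -` A)"
  by (subst normal_shift[symmetric], subst emeasure_distr) simp_all

lemma inner_axis_1: "(x :: complex ^ 'm) \<bullet> axis k 1 = Re (x $ k)"
  and inner_axis_ii: "(x :: complex ^ 'm) \<bullet> axis k \<i> = Im (x $ k)"
  by (simp_all add: inner_axis inner_complex_def)

lemma axis_in_Basis_complex: "axis k 1 \<in> (Basis :: (complex ^ 'm) set)" "axis k \<i> \<in> (Basis :: (complex ^ 'm) set)"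
  "axis k 1 \<noteq> (axis k \<i> :: complex ^ 'm)"
  by (auto simp: Basis_vec_def Basis_complex_def axis_eq_axis complex_eq_iff)

lemma emeasure_gauss_coordinate:
  assumes "S \<in> sets borel" "T \<in> sets borel"
  shows "emeasure gauss {x :: complex ^ 'm. Re (x $ k) \<in> S \<and> Im (x $ k) \<in> T} =
    emeasure (normal 0) S * emeasure (normal 0) T"
proof -
  let ?e = "axis k 1 :: complex ^ 'm" and ?f = "axis k \<i> :: complex ^ 'm"
  define A where "A b = (if b = ?e then S else if b = ?f then T else UNIV)" for b
  note ax = axis_in_Basis_complex[of k]
  have one: "emeasure (normal 0) UNIV = 1"
    using prob_space.emeasure_space_1[OF prob_space_normal[of 0]] by simp
  have "{x :: complex ^ 'm. Re (x $ k) \<in> S \<and> Im (x $ k) \<in> T} = {x. \<forall>b\<in>Basis. x \<bullet> b \<in> A b}"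
    using ax by (auto simp: A_def inner_axis_1 inner_axis_ii)
  also have "emeasure gauss \<dots> = (\<Prod>b\<in>Basis. emeasure (normal 0) (A b))"
    by (rule emeasure_gauss_box) (use assms in \<open>simp add: A_def\<close>)
  also have "\<dots> = (\<Prod>b\<in>{?e, ?f}. emeasure (normal 0) (A b))"
    using ax by (intro prod.mono_neutral_right) (auto simp: A_def one)
  also have "\<dots> = emeasure (normal 0) S * emeasure (normal 0) T"
    using ax(3) by (simp add: A_def)
  finally show ?thesis .
qed

lemma prod_double: "(\<Prod>i<2 * l. f i) = (\<Prod>j<l. f (2 * j) * f (2 * j + 1 :: nat))"
  by (induction l) (simp_all add: mult.assoc)

lemma sum_double: "(\<Sum>i<2 * l. f i) = (\<Sum>j<l. f (2 * j) + f (2 * j + 1 :: nat))"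
  by (induction l) (simp_all add: add.assoc)

text \<open>Serves both A, with shifts \<open>a\<close> coming from the means, and C, with
  \<open>a = 0\<close>. The real and imaginary parts of \<open>w (J j) $ k\<close> become the real
  variables with indices \<open>2 * j\<close> and \<open>2 * j + 1\<close>; they are independent
  since \<open>J\<close> picks distinct vectors.\<close>

lemma noncentral_chi_squared_gauss_coordinates:
  fixes a :: "nat \<Rightarrow> real" and J :: "nat \<Rightarrow> 'i" and k :: "'m::finite"
  assumes J: "inj_on J {..<l}" "J \<in> {..<l} \<rightarrow> I"
  shows "distr (\<Pi>\<^sub>M i\<in>I. gauss :: (complex ^ 'm) measure) borel
      (\<lambda>w. \<Sum>j<l. (a (2 * j) + Re (w (J j) $ k))\<^sup>2 + (a (2 * j + 1) + Im (w (J j) $ k))\<^sup>2) =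
    distr (\<Pi>\<^sub>M i\<in>{..<2 * l}. normal (a i)) borel (\<lambda>g. \<Sum>i<2 * l. (g i)\<^sup>2)"
proof -
  let ?G = "\<Pi>\<^sub>M j\<in>{..<l}. gauss :: (complex ^ 'm) measure"
  let ?N = "\<Pi>\<^sub>M i\<in>{..<2 * l}. normal (a i)"
  let ?c = "\<lambda>w i. a i + (if even i then Re else Im) (w (i div 2) $ k)"
  let ?h = "\<lambda>w::nat \<Rightarrow> complex ^ 'm. \<lambda>i\<in>{..<2 * l}. ?c w i"
  interpret G: product_prob_space "\<lambda>_. gauss :: (complex ^ 'm) measure" "{..<l}"
    by (intro product_prob_spaceI prob_space_gauss)
  interpret N: product_prob_space "\<lambda>i. normal (a i)" "{..<2 * l}"
    by (intro product_prob_spaceI prob_space_normal)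
  have [measurable]: "(\<lambda>x. Re (x $ k)) \<in> borel_measurable borel" "(\<lambda>x. Im (x $ k)) \<in> borel_measurable borel"
    by (intro borel_measurable_continuous_onI continuous_intros)+
  have h: "?h \<in> ?G \<rightarrow>\<^sub>M ?N"
  proof (rule measurable_restrict)
    fix i assume "i \<in> {..<2 * l}"
    then have i: "i div 2 \<in> {..<l}" by auto
    show "(\<lambda>w. ?c w i) \<in> ?G \<rightarrow>\<^sub>M normal (a i)"
    proof -
      have [measurable]: "(\<lambda>w. w (i div 2)) \<in> borel_measurable ?G"
        using measurable_component_singleton[OF i, of "\<lambda>_. gauss"]
        by (simp add: measurable_cong_sets[OF refl sets_gauss])
      show ?thesis by (cases "even i") simp_all
    qed
  qed
  have "distr ?G ?N ?h = ?N"
  proof (rule N.PiM_eqI)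
    fix A assume A: "\<And>i. i \<in> {..<2 * l} \<Longrightarrow> A i \<in> sets (normal (a i))"
    \<comment> \<open>A box in the real coordinates pulls back to a product over \<open>j\<close>,
      since the conditions with indices \<open>2 * j\<close> and \<open>2 * j + 1\<close> concern
      the single vector \<open>w j\<close>.\<close>
    define B where "B j = {x :: complex ^ 'm. Re (x $ k) \<in> (+) (a (2 * j)) -` A (2 * j) \<and>
        Im (x $ k) \<in> (+) (a (2 * j + 1)) -` A (2 * j + 1)}" for j
    have A': "A (2 * j) \<in> sets borel" "A (2 * j + 1) \<in> sets borel" if "j < l" for j
      using A[of "2 * j"] A[of "2 * j + 1"] that by auto
    have sh: "(+) (a i) -` X \<in> sets borel" if "X \<in> sets borel" for i X
      using measurable_sets[OF _ that, of "(+) (a i)" borel] by simp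
    have B: "B j \<in> sets borel" if "j < l" for j
    proof -
      have "{x \<in> space borel. Re (x $ k) \<in> S \<and> Im (x $ k) \<in> T} \<in> sets (borel :: (complex ^ 'm) measure)"
        if [measurable]: "S \<in> sets borel" "T \<in> sets borel" for S T
        by measurable
      then show ?thesis using sh A'[OF that] by (simp add: B_def)
    qed
    have "?h -` Pi\<^sub>E {..<2 * l} A \<inter> space ?G = Pi\<^sub>E {..<l} B"
    proof (intro set_eqI iffI)
      fix w assume w: "w \<in> ?h -` Pi\<^sub>E {..<2 * l} A \<inter> space ?G"
      then have c: "?c w i \<in> A i" if "i < 2 * l" for i using that by (auto simp: PiE_iff)
      show "w \<in> Pi\<^sub>E {..<l} B"
        using w c[of "2 * _"] c[of "2 * _ + 1"] by (auto simp: PiE_iff space_PiM B_def)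
    next
      fix w assume w: "w \<in> Pi\<^sub>E {..<l} B"
      have "?c w i \<in> A i" if "i < 2 * l" for i
      proof -
        have "w (i div 2) \<in> B (i div 2)" using w that by (auto simp: PiE_iff)
        then show ?thesis by (cases "even i") (auto simp: B_def elim!: evenE oddE)
      qed
      then show "w \<in> ?h -` Pi\<^sub>E {..<2 * l} A \<inter> space ?G"
        using w by (auto simp: PiE_iff space_PiM)
    qed
    then have "emeasure (distr ?G ?N ?h) (Pi\<^sub>E {..<2 * l} A) = emeasure ?G (Pi\<^sub>E {..<l} B)"
      using A by (subst emeasure_distr[OF h]) (auto intro!: sets_PiM_I_finite)
    also have "\<dots> = (\<Prod>j<l. emeasure gauss (B j))"
      using B by (intro G.emeasure_PiM) auto
    also have "\<dots> = (\<Prod>j<l. emeasure (normal (a (2 * j))) (A (2 * j)) * emeasure (normal (a (2 * j + 1))) (A (2 * j + 1)))"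
      using A' sh unfolding B_def
      by (intro prod.cong refl, subst emeasure_gauss_coordinate) (auto simp: emeasure_normal_shift)
    finally show "emeasure (distr ?G ?N ?h) (Pi\<^sub>E {..<2 * l} A) = (\<Prod>i<2 * l. emeasure (normal (a i)) (A i))"
      by (simp only: prod_double)
  qed simp_all
  \<comment> \<open>Passing to the coordinates selected by \<open>J\<close> is a mere reindexing of
    independent factors.\<close>
  moreover have "distr (\<Pi>\<^sub>M i\<in>I. gauss :: (complex ^ 'm) measure) ?G (\<lambda>w. \<lambda>j\<in>{..<l}. w (J j)) = ?G"
    using J by (intro distr_PiM_reindex prob_space_gauss)
  ultimately have "?N = distr (distr (\<Pi>\<^sub>M i\<in>I. gauss :: (complex ^ 'm) measure) ?G (\<lambda>w. \<lambda>j\<in>{..<l}. w (J j))) ?N ?h"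
    by simp
  also have "\<dots> = distr (\<Pi>\<^sub>M i\<in>I. gauss :: (complex ^ 'm) measure) ?N (?h \<circ> (\<lambda>w. \<lambda>j\<in>{..<l}. w (J j)))"
    using J by (intro distr_distr h measurable_restrict measurable_component_singleton) auto
  finally have "distr ?N borel (\<lambda>g. \<Sum>i<2 * l. (g i)\<^sup>2) =
      distr (distr (\<Pi>\<^sub>M i\<in>I. gauss :: (complex ^ 'm) measure) ?N (?h \<circ> (\<lambda>w. \<lambda>j\<in>{..<l}. w (J j)))) borel (\<lambda>g. \<Sum>i<2 * l. (g i)\<^sup>2)"
    by simp
  also have "\<dots> = distr (\<Pi>\<^sub>M i\<in>I. gauss :: (complex ^ 'm) measure) borel
      ((\<lambda>g. \<Sum>i<2 * l. (g i)\<^sup>2) \<circ> (?h \<circ> (\<lambda>w. \<lambda>j\<in>{..<l}. w (J j))))"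
  proof (rule distr_distr)
    show "(\<lambda>g. \<Sum>i<2 * l. (g i)\<^sup>2) \<in> borel_measurable ?N" by measurable
    show "?h \<circ> (\<lambda>w. \<lambda>j\<in>{..<l}. w (J j)) \<in> (\<Pi>\<^sub>M i\<in>I. gauss :: (complex ^ 'm) measure) \<rightarrow>\<^sub>M ?N"
      using J by (intro measurable_comp[OF _ h] measurable_restrict measurable_component_singleton) auto
  qed
  also have "(\<lambda>g. \<Sum>i<2 * l. (g i)\<^sup>2) \<circ> (?h \<circ> (\<lambda>w. \<lambda>j\<in>{..<l}. w (J j))) =
      (\<lambda>w. \<Sum>j<l. (a (2 * j) + Re (w (J j) $ k))\<^sup>2 + (a (2 * j + 1) + Im (w (J j) $ k))\<^sup>2)"
    unfolding sum_double by (simp add: fun_eq_iff)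
  finally show ?thesis by simp
qed

text \<open>
  A unitary map taking \<open>v\<close> to a coordinate vector: the reflection exchanging \<open>v\<close> with
  \<open>q *s axis k 1\<close>, where \<open>q\<close> is the phase of \<open>v $ k\<close>, followed by multiplication by \<open>cnj q\<close>.
\<close>
lemma unitary_to_axis:
  fixes v :: "complex ^ 'm::finite" and k :: 'm
  assumes v: "norm v = 1"
  obtains U where "orthogonal_transformation U" "\<And>x. U x $ k = cip v x"
proof -
  define q where "q = (if v $ k = 0 then 1 else sgn (v $ k))"
  have q1: "cmod q = 1" by (simp add: q_def norm_sgn)
  then have qq: "cnj q * q = 1" using complex_norm_square[of q, symmetric]
    unfolding q1 by (simp add: mult.commute)
  have qv: "cnj q * v $ k = complex_of_real (cmod (v $ k))"
    using complex_norm_square[of "v $ k"] by (simp add: q_def sgn_eq power2_eq_square field_simps)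
  define e where "e = q *s (axis k 1 :: complex ^ 'm)"
  have ee: "cip e e = 1"
    unfolding e_def using qq by (simp add: cip_simps cip_axis mult.commute)
  have vv: "cip v v = 1" using v by (simp add: cip_self)
  \<comment> \<open>The phase \<open>q\<close> makes this product real. That is necessary: a unitary
    map exchanging \<open>e\<close> and \<open>v\<close> sends their product to its
    conjugate.\<close>
  have ev: "cip e v = complex_of_real (cmod (v $ k))" unfolding e_def by (simp add: cip_simps cip_axis qv)
  have ve: "cip v e = complex_of_real (cmod (v $ k))" using ev cnj_cip[of e v] by simp
  define u where "u = e - v"
  have eu: "2 * cip e u = cip u u"
    by (simp add: u_def cip_simps ee ev ve vv)
  \<comment> \<open>If \<open>u = 0\<close> the two vectors coincide and \<open>R\<close> is the
    identity; otherwise \<open>R\<close> is the reflection in the hyperplane orthogonal to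
    \<open>u\<close>.\<close>
  define c where "c = (if u = 0 then 0 else 2 / (norm u)\<^sup>2)"
  define R where "R x = x - (complex_of_real c * cip u x) *s u" for x
  have cu: "complex_of_real c * cip u u = (if u = 0 then 0 else 2)"
    by (simp add: c_def cip_self)
  have eR: "cip e (R x) = cip v x" for x
  proof -
    have "cip e (R x) = cip e x - cip u x * (complex_of_real c * cip e u)"
      by (simp add: R_def cip_simps)
    also have "2 * (complex_of_real c * cip e u) = (if u = 0 then 0 else 2)"
      using cu eu by (metis mult.left_commute)
    then have "complex_of_real c * cip e u = (if u = 0 then 0 else 1)" by (simp split: if_splits)
    also have "cip e x - cip u x * (if u = 0 then 0 else 1) = cip e x - cip u x"
      by (simp add: cip_simps)
    finally show ?thesis by (simp add: u_def cip_simps)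
  qed
  have nR: "norm (R x) = norm x" for x
  proof -
    have "cip (R x) (R x) = cip x x - 2 * complex_of_real c * cip u x * cip x u +
        complex_of_real c * cip x u * cip u x * (complex_of_real c * cip u u)"
      by (simp add: R_def cip_simps cnj_cip algebra_simps)
    also have "\<dots> = cip x x"
      unfolding cu by (simp add: cip_simps)
    finally have "(norm (R x))\<^sup>2 = (norm x)\<^sup>2"
      unfolding cip_self of_real_eq_iff .
    then show ?thesis by simp
  qed
  define U where "U x = cnj q *s R x" for x
  have "linear U"
  proof (rule linearI)
    fix x y r
    show "U (x + y) = U x + U y" "U (r *\<^sub>R x) = r *\<^sub>R U x"
      by (simp_all add: U_def R_def vec_eq_iff cip_simps scaleR_eq_cvec_scale algebra_simps)
  qed
  then have "orthogonal_transformation U"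
    by (simp add: orthogonal_transformation U_def norm_cvec_scale nR q1)
  moreover have "U x $ k = cip v x" for x
    using eR[of x] by (simp add: U_def e_def cip_simps cip_axis)
  ultimately show ?thesis using that by blast
qed

section \<open>Projection onto the complement of a unit vector\<close>

definition perp :: "complex ^ 'm \<Rightarrow> complex ^ 'm \<Rightarrow> complex ^ 'm" where
  "perp v x = x - cip v x *s v"

lemma norm_perp:
  assumes "norm v = 1"
  shows "(norm (perp v x))\<^sup>2 = (norm x)\<^sup>2 - (cmod (cip v x))\<^sup>2"
  using norm_cvec_add_orthogonal[of "perp v x" "cip v x *s v"] assms cnj_cip[of v x]
  by (simp add: perp_def cip_simps cip_self norm_cvec_scale mult.commute)

lemma perp_orthogonal: "norm v = 1 \<Longrightarrow> cip v (perp v x) = 0"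
  by (simp add: perp_def cip_simps cip_self)

lemma perp_add: "perp v (x + y) = perp v x + perp v y"
  and perp_diff: "perp v (x - y) = perp v x - perp v y"
  and perp_scale: "perp v (c *s x) = c *s perp v x"
  by (simp_all add: perp_def cip_simps vec_eq_iff algebra_simps)

text \<open>Rotate \<open>v\<close> to coordinate \<open>k\<close>. The squared norm of the
  projection is then the sum of the squares of all real coordinates but the two belonging to entry
  \<open>k\<close>, which leaves 2m - 2 of them, none if m = 1.\<close>

lemma chi_squared_norm_perp:
  fixes v :: "complex ^ 'm"
  assumes v: "norm v = 1"
  shows "distr gauss borel (\<lambda>x. (norm (perp v x))\<^sup>2) = chi_squared (2 * CARD('m) - 2)"
proof -
  obtain k :: 'm where True by simp
  let ?S = "Basis - {axis k 1, axis k \<i>} :: (complex ^ 'm) set"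
  let ?n = "2 * CARD('m) - 2"
  let ?B = "\<Pi>\<^sub>M b\<in>(Basis :: (complex ^ 'm) set). normal 0"
  let ?N = "\<Pi>\<^sub>M i\<in>{..<?n}. normal 0"
  obtain U where U: "orthogonal_transformation U" "\<And>x. U x $ k = cip v x"
    using unitary_to_axis[OF v] by blast
  have nU: "norm (U x) = norm x" for x using U(1) by (simp add: orthogonal_transformation)
  have Um: "U \<in> borel_measurable borel"
    using U(1) by (intro borel_measurable_continuous_onI linear_continuous_on linear_conv_bounded_linear[THEN iffD1])
        (simp add: orthogonal_transformation_def)
  have sum_S: "(norm y)\<^sup>2 - (cmod (y $ k))\<^sup>2 = (\<Sum>b\<in>?S. (y \<bullet> b)\<^sup>2)" for y :: "complex ^ 'm"
  proof -
    have "(norm y)\<^sup>2 = (\<Sum>b\<in>Basis. (y \<bullet> b)\<^sup>2)"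
      by (subst power2_norm_eq_inner, subst euclidean_inner) (simp add: power2_eq_square)
    also have "\<dots> = (\<Sum>b\<in>?S. (y \<bullet> b)\<^sup>2) + (\<Sum>b\<in>{axis k 1, axis k \<i>}. (y \<bullet> b)\<^sup>2)"
      using axis_in_Basis_complex[of k] by (intro sum.subset_diff) auto
    also have "(\<Sum>b\<in>{axis k 1, axis k \<i>}. (y \<bullet> b)\<^sup>2) = (cmod (y $ k))\<^sup>2"
      using axis_in_Basis_complex(3)[of k] by (simp add: inner_axis_1 inner_axis_ii cmod_power2)
    finally show ?thesis by simp
  qed
  have "card ?S = card {..<?n}"
    using axis_in_Basis_complex[of k] by (subst card_Diff_subset) auto
  then obtain f where f: "bij_betw f {..<?n} ?S"
    using finite_same_card_bij[of "{..<?n}" ?S] by auto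
  have "distr gauss borel (\<lambda>x. (norm (perp v x))\<^sup>2) = distr gauss borel ((\<lambda>y. \<Sum>b\<in>?S. (y \<bullet> b)\<^sup>2) \<circ> U)"
    unfolding norm_perp[OF v] comp_def sum_S[symmetric] nU U(2) ..
  also have "\<dots> = distr (distr gauss borel U) borel (\<lambda>y. \<Sum>b\<in>?S. (y \<bullet> b)\<^sup>2)"
    by (rule distr_distr[symmetric]) (use Um in \<open>simp_all add: measurable_cong_sets[OF sets_gauss refl]\<close>)
  also have "\<dots> = distr gauss borel (\<lambda>y. \<Sum>b\<in>?S. (y \<bullet> b)\<^sup>2)"
    by (simp add: gauss_distr_orthogonal[OF U(1)])
  also have "\<dots> = distr gauss borel ((\<lambda>g. \<Sum>b\<in>?S. (g b)\<^sup>2) \<circ> (\<lambda>x. \<lambda>b\<in>Basis. x \<bullet> b))"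
    by (simp add: comp_def)
  also have "\<dots> = distr (distr gauss ?B (\<lambda>x. \<lambda>b\<in>Basis. x \<bullet> b)) borel (\<lambda>g. \<Sum>b\<in>?S. (g b)\<^sup>2)"
    by (rule distr_distr[symmetric], measurable)
  also have "\<dots> = distr ?B borel ((\<lambda>g. \<Sum>i<?n. (g i)\<^sup>2) \<circ> (\<lambda>g. \<lambda>i\<in>{..<?n}. g (f i)))"
  proof -
    have "(\<Sum>b\<in>?S. (g b)\<^sup>2) = (\<Sum>i<?n. (g (f i))\<^sup>2)" for g :: "complex ^ 'm \<Rightarrow> real"
      by (rule sum.reindex_bij_betw[OF f, symmetric])
    then show ?thesis by (simp add: gauss_Basis_coordinates comp_def)
  qed
  also have "\<dots> = distr (distr ?B ?N (\<lambda>g. \<lambda>i\<in>{..<?n}. g (f i))) borel (\<lambda>g. \<Sum>i<?n. (g i)\<^sup>2)"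
    by (rule distr_distr[symmetric], measurable)
      (use f in \<open>auto simp: bij_betw_def intro!: measurable_restrict measurable_component_singleton\<close>)
  also have "distr ?B ?N (\<lambda>g. \<lambda>i\<in>{..<?n}. g (f i)) = ?N"
    using f by (intro distr_PiM_reindex prob_space_normal) (auto simp: bij_betw_def)
  finally show ?thesis by (simp add: chi_squared_def)
qed

section \<open>Rotating the columns\<close>

lemma borel_measurable_vec_scale [measurable (raw)]:
  fixes f :: "'w \<Rightarrow> complex" and g :: "'w \<Rightarrow> complex ^ 'm"
  assumes "f \<in> borel_measurable M" "g \<in> borel_measurable M"
  shows "(\<lambda>w. f w *s g w) \<in> borel_measurable M"
  by (rule borel_measurable_continuous_Pair[OF assms])
    (simp add: vector_scalar_mult_def, intro continuous_intros)

lemma borel_measurable_cip [measurable (raw)]: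
  fixes f g :: "'w \<Rightarrow> complex ^ 'm"
  assumes "f \<in> borel_measurable M" "g \<in> borel_measurable M"
  shows "(\<lambda>w. cip (f w) (g w)) \<in> borel_measurable M"
  by (rule borel_measurable_continuous_Pair[OF assms])
    (simp add: cip_def, intro continuous_intros)

lemma borel_measurable_outer [measurable (raw)]:
  fixes f :: "'w \<Rightarrow> complex ^ 'm"
  assumes "f \<in> borel_measurable M"
  shows "(\<lambda>w. outer (f w)) \<in> borel_measurable M"
  by (rule borel_measurable_continuous_on[OF _ assms])
    (simp add: outer_def, intro continuous_intros)

lemma borel_measurable_vec_nth_complex [measurable (raw)]:
  fixes f :: "'w \<Rightarrow> complex ^ 'm"
  assumes "f \<in> borel_measurable M"
  shows "(\<lambda>w. f w $ i) \<in> borel_measurable M"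
  by (rule borel_measurable_continuous_on[OF _ assms]) (intro continuous_intros)

lemma borel_measurable_perp [measurable (raw)]:
  assumes [measurable]: "f \<in> borel_measurable M"
  shows "(\<lambda>w. perp v (f w)) \<in> borel_measurable M"
  unfolding perp_def by measurable

lemma borel_measurable_cnj [measurable (raw)]:
  "f \<in> borel_measurable M \<Longrightarrow> (\<lambda>w. cnj (f w)) \<in> borel_measurable M"
  by (rule borel_measurable_continuous_on[where f = cnj]) (intro continuous_intros)

text \<open>For unit vectors \<open>f\<close> and \<open>g\<close>, swaps the component of the first
  vector along \<open>f\<close> with the component of the second along \<open>g\<close>. A Gaussian
  component in a random direction can thus be traded for a fixed coordinate of a fresh
  vector.\<close>

definition exchange :: "complex ^ 'm \<Rightarrow> complex ^ 'm \<Rightarrow> (complex ^ 'm) \<times> (complex ^ 'm) \<Rightarrow> (complex ^ 'm) \<times> (complex ^ 'm)" where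
  "exchange f g p = (fst p + (cip g (snd p) - cip f (fst p)) *s f, snd p + (cip f (fst p) - cip g (snd p)) *s g)"

lemma norm_replace_component:
  assumes "norm f = 1"
  shows "(norm (x + (c - cip f x) *s f))\<^sup>2 = (norm x)\<^sup>2 - (cmod (cip f x))\<^sup>2 + (cmod c)\<^sup>2"
proof -
  have "x + (c - cip f x) *s f = perp f x + c *s f"
    by (simp add: perp_def vec_eq_iff algebra_simps)
  moreover have "cip (perp f x) (c *s f) = 0"
    using perp_orthogonal[OF assms, of x] cnj_cip[of f "perp f x"] by (simp add: cip_simps)
  ultimately show ?thesis
    using norm_cvec_add_orthogonal[of "perp f x" "c *s f"] assms
    by (simp only: norm_perp norm_cvec_scale mult_1_right)
qed

lemma orthogonal_transformation_exchange:
  assumes "norm f = 1" "norm g = 1"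
  shows "orthogonal_transformation (exchange f g)"
  unfolding orthogonal_transformation
proof (intro conjI allI)
  show "linear (exchange f g)"
    by (rule linearI) (auto simp: exchange_def vec_eq_iff cip_simps scaleR_eq_cvec_scale algebra_simps)
  show "norm (exchange f g p) = norm p" for p
    unfolding norm_prod_def exchange_def fst_conv snd_conv
      norm_replace_component[OF assms(1)] norm_replace_component[OF assms(2)] by simp
qed

text \<open>
  The right multiplication of \<open>(x, y)\<close> by a unitary matrix that takes the row \<open>(a, r)\<close> to
  \<open>(sqrt (|a|\<^sup>2 + |r|\<^sup>2), 0)\<close>.
\<close>
definition givens :: "complex \<Rightarrow> complex \<Rightarrow> (complex ^ 'm) \<times> (complex ^ 'm) \<Rightarrow> (complex ^ 'm) \<times> (complex ^ 'm)" where
  "givens a r p = (let \<rho> = complex_of_real (sqrt ((cmod a)\<^sup>2 + (cmod r)\<^sup>2)) in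
     if \<rho> = 0 then p
     else ((cnj a / \<rho>) *s fst p + (cnj r / \<rho>) *s snd p, (- r / \<rho>) *s fst p + (a / \<rho>) *s snd p))"

lemma orthogonal_transformation_givens: "orthogonal_transformation (givens a r)"
  unfolding orthogonal_transformation
proof (intro conjI allI)
  define \<rho> where "\<rho> = complex_of_real (sqrt ((cmod a)\<^sup>2 + (cmod r)\<^sup>2))"
  have cnj\<rho>: "cnj \<rho> = \<rho>" by (simp add: \<rho>_def)
  have \<rho>2: "\<rho> * \<rho> = a * cnj a + r * cnj r"
    unfolding \<rho>_def complex_norm_square[symmetric] of_real_mult[symmetric] of_real_add[symmetric] by simp
  show "linear (givens a r)"
    by (rule linearI) (auto simp: givens_def Let_def vec_eq_iff scaleR_eq_cvec_scale algebra_simps add_divide_distrib diff_divide_distrib)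
  fix p :: "(complex ^ 'm) \<times> (complex ^ 'm)"
  show "norm (givens a r p) = norm p"
  proof (cases "\<rho> = 0")
    case False
    define x y where "x = fst p" "y = snd p"
    let ?x = "(cnj a / \<rho>) *s x + (cnj r / \<rho>) *s y" and ?y = "(- r / \<rho>) *s x + (a / \<rho>) *s y"
    have "cip ?x ?x + cip ?y ?y = ((a * cnj a + r * cnj r) / (\<rho> * \<rho>)) * (cip x x + cip y y)"
      using False by (simp add: cip_simps cnj\<rho> field_simps)
    also have "\<dots> = cip x x + cip y y" using False by (simp flip: \<rho>2)
    finally have "(norm ?x)\<^sup>2 + (norm ?y)\<^sup>2 = (norm x)\<^sup>2 + (norm y)\<^sup>2"
      unfolding cip_self of_real_add[symmetric] of_real_eq_iff .
    then show ?thesis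
      using False by (simp add: norm_prod_def givens_def Let_def x_y_def flip: \<rho>_def)
  qed (simp add: givens_def flip: \<rho>_def)
qed

text \<open>The sum is X X^dagger for the matrix X with columns \<open>x\<close> and
  \<open>y\<close>, and it is unchanged when X is multiplied on the right by a unitary
  matrix.\<close>

lemma outer_givens:
  fixes x y :: "complex ^ 'm"
  shows "outer (fst (givens a r (x, y))) + outer (snd (givens a r (x, y))) = outer x + outer y"
proof -
  define \<rho> where "\<rho> = complex_of_real (sqrt ((cmod a)\<^sup>2 + (cmod r)\<^sup>2))"
  have cnj\<rho>: "cnj \<rho> = \<rho>" by (simp add: \<rho>_def)
  have \<rho>2: "\<rho> * \<rho> = a * cnj a + r * cnj r"
    unfolding \<rho>_def complex_norm_square[symmetric] of_real_mult[symmetric] of_real_add[symmetric] by simp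
  show ?thesis
  proof (cases "\<rho> = 0")
    case False
    have "((cnj a / \<rho>) * s + (cnj r / \<rho>) * t) * ((a / \<rho>) * cnj s' + (r / \<rho>) * cnj t') +
        ((- r / \<rho>) * s + (a / \<rho>) * t) * ((- cnj r / \<rho>) * cnj s' + (cnj a / \<rho>) * cnj t') = s * cnj s' + t * cnj t'"
      for s t s' t'
    proof -
      have "((cnj a / \<rho>) * s + (cnj r / \<rho>) * t) * ((a / \<rho>) * cnj s' + (r / \<rho>) * cnj t') +
          ((- r / \<rho>) * s + (a / \<rho>) * t) * ((- cnj r / \<rho>) * cnj s' + (cnj a / \<rho>) * cnj t') =
          ((a * cnj a + r * cnj r) / (\<rho> * \<rho>)) * (s * cnj s' + t * cnj t')"
        using False by (simp add: field_simps)
      then show ?thesis using False by (simp flip: \<rho>2)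
    qed
    then show ?thesis
      using False by (simp add: vec_eq_iff outer_def givens_def Let_def cnj\<rho> flip: \<rho>_def)
  qed (simp add: givens_def flip: \<rho>_def)
qed

text \<open>Column \<open>j\<close> has mean \<open>\<mu> j *s v\<close>, and \<open>s\<close> is
  the standard deviation of each real coordinate, that is \<sigma> / sqrt 2. The index
  \<open>k\<close> is arbitrary; it names the entry that is read off the reservoir vectors.\<close>

locale gaussian_columns =
  fixes v :: "complex ^ 'm::finite" and k :: 'm and n :: nat and s :: real and \<mu> :: "nat \<Rightarrow> complex"
  assumes v: "norm v = 1" and n: "n \<ge> 1" and s: "s > 0"
begin

text \<open>Neither \<open>s\<close> nor the means enter the measure, so a single probability space
  carries the matrices for all \<sigma>.\<close>

definition base :: "(nat \<Rightarrow> complex ^ 'm) measure" where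
  "base = (\<Pi>\<^sub>M i\<in>{..<3 * n}. gauss)"

text \<open>
  The sample points carry three blocks of \<open>n\<close> vectors: the first provides the components along \<open>v\<close> of the
  columns, the second their components orthogonal to \<open>v\<close>, and the third their components along the
  vector \<open>b\<close> below.
\<close>
definition row :: "nat \<Rightarrow> (nat \<Rightarrow> complex ^ 'm) \<Rightarrow> complex" where
  "row j w = \<mu> j + of_real s * (w j $ k)"

text \<open>The entry along \<open>v\<close> of column 0 after the Givens steps 1 to
  \<open>i\<close>. It is complex at the start and a nonnegative real after the first step; its
  squared modulus accumulates those of the rows.\<close>

primrec radius :: "nat \<Rightarrow> (nat \<Rightarrow> complex ^ 'm) \<Rightarrow> complex" where
  "radius 0 w = row 0 w"
| "radius (Suc i) w = complex_of_real (sqrt ((cmod (radius i w))\<^sup>2 + (cmod (row (Suc i) w))\<^sup>2))"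

definition b :: "(nat \<Rightarrow> complex ^ 'm) \<Rightarrow> complex ^ 'm" where
  "b w = perp v (w n)"

text \<open>Trades the component along the unit vector in direction \<open>b w\<close> for a
  reservoir coordinate. If \<open>b w = 0\<close>, as always for m = 1, there is no direction to
  trade and the products with \<open>b w\<close> vanish anyway.\<close>

definition turn :: "(nat \<Rightarrow> complex ^ 'm) \<Rightarrow> (complex ^ 'm) \<times> (complex ^ 'm) \<Rightarrow> (complex ^ 'm) \<times> (complex ^ 'm)" where
  "turn w = (if b w = 0 then (\<lambda>p. p) else exchange (complex_of_real (1 / norm (b w)) *s b w) (axis k 1))"

definition d :: "nat \<Rightarrow> (nat \<Rightarrow> complex ^ 'm) \<Rightarrow> complex ^ 'm" where
  "d j w = perp v (fst (turn w (w (n + j), w (2 * n + j))))"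

text \<open>The three stage families interpolate from the given Wishart matrix,
  \<open>split_stage 0\<close>, to \<open>turn_stage (n - 1)\<close>, changing one column index at a
  time. In this family the columns before \<open>i\<close> already take their component along
  \<open>v\<close> from the first block.\<close>

definition split_stage :: "nat \<Rightarrow> (nat \<Rightarrow> complex ^ 'm) \<Rightarrow> complex ^ 'm ^ 'm" where
  "split_stage i w = (\<Sum>j<n. outer (if j < i then row j w *s v + of_real s *s perp v (w (n + j))
     else \<mu> j *s v + of_real s *s w (n + j)))"

text \<open>The components along \<open>v\<close> of columns 1 to \<open>i\<close> have been rotated
  into column 0.\<close>

definition givens_stage :: "nat \<Rightarrow> (nat \<Rightarrow> complex ^ 'm) \<Rightarrow> complex ^ 'm ^ 'm" where
  "givens_stage i w = (\<Sum>j<n. outer ((if j = 0 then radius i w else if j \<le> i then 0 else row j w) *s v +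
     of_real s *s perp v (w (n + j))))"

text \<open>The components along \<open>b w\<close> of columns 1 to \<open>i\<close> have been
  replaced by fresh variables; column 0 is the one that carries \<open>b w\<close> itself.\<close>

definition turn_stage :: "nat \<Rightarrow> (nat \<Rightarrow> complex ^ 'm) \<Rightarrow> complex ^ 'm ^ 'm" where
  "turn_stage i w = (\<Sum>j<n. outer ((if j = 0 then radius (n - 1) w else 0) *s v +
     of_real s *s (if j = 0 \<or> i < j then perp v (w (n + j)) else d j w)))"

section \<open>Measurability of the stages\<close>

lemma coordinate_measurable: "j < 3 * n \<Longrightarrow> (\<lambda>w. w j) \<in> borel_measurable base"
  using measurable_component_singleton[of j "{..<3 * n}" "\<lambda>_. gauss"]
  by (simp add: base_def measurable_cong_sets[OF refl sets_gauss])

lemma row_measurable: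
  assumes "j < n"
  shows "row j \<in> borel_measurable base"
proof -
  have [measurable]: "(\<lambda>w. w j) \<in> borel_measurable base" using assms by (intro coordinate_measurable) simp
  show ?thesis unfolding row_def by measurable
qed

lemma radius_measurable: "i < n \<Longrightarrow> radius i \<in> borel_measurable base"
proof (induction i)
  case 0
  then show ?case using row_measurable by simp
next
  case (Suc i)
  then have [measurable]: "radius i \<in> borel_measurable base" "row (Suc i) \<in> borel_measurable base"
    using row_measurable by auto
  show ?case by simp
qed

lemma b_measurable [measurable]: "b \<in> borel_measurable base"
proof -
  have [measurable]: "(\<lambda>w. w n) \<in> borel_measurable base" using n by (intro coordinate_measurable) simp
  show ?thesis unfolding b_def by measurable
qed

lemma norm_unit_b: "b w \<noteq> 0 \<Longrightarrow> norm (complex_of_real (1 / norm (b w)) *s b w) = 1"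
  unfolding norm_cvec_scale norm_of_real by simp

lemma norm_axis_1: "norm (axis k 1 :: complex ^ 'm) = 1"
  by (simp add: norm_eq_1 inner_axis_axis)

lemma turn_measurable:
  assumes "j < n"
  shows "(\<lambda>w. turn w (w (n + j), w (2 * n + j))) \<in> borel_measurable base"
proof -
  have [measurable]: "(\<lambda>w. w (n + j)) \<in> borel_measurable base" "(\<lambda>w. w (2 * n + j)) \<in> borel_measurable base"
    using assms by (auto intro!: coordinate_measurable)
  have "(\<lambda>w. turn w (w (n + j), w (2 * n + j))) = (\<lambda>w. if b w = 0 then (w (n + j), w (2 * n + j))
      else exchange (complex_of_real (1 / norm (b w)) *s b w) (axis k 1) (w (n + j), w (2 * n + j)))"
    by (auto simp: turn_def)
  then show ?thesis
    unfolding exchange_def fst_conv snd_conv by (simp only:) measurable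
qed

lemma d_measurable: "j < n \<Longrightarrow> d j \<in> borel_measurable base"
  unfolding d_def by (intro borel_measurable_perp measurable_compose[OF turn_measurable])
    (auto intro!: borel_measurable_continuous_onI continuous_intros)

lemma stage_measurable:
  "split_stage i \<in> borel_measurable base"
  "i < n \<Longrightarrow> givens_stage i \<in> borel_measurable base"
  "turn_stage i \<in> borel_measurable base"
proof -
  have [measurable]: "d j \<in> borel_measurable base" "row j \<in> borel_measurable base"
    "radius j \<in> borel_measurable base" "(\<lambda>w. w (n + j)) \<in> borel_measurable base" if "j < n" for j
    using that by (auto intro!: coordinate_measurable d_measurable row_measurable radius_measurable)
  show "split_stage i \<in> borel_measurable base"
    unfolding split_stage_def
  proof (intro borel_measurable_sum borel_measurable_outer)
    fix j assume "j \<in> {..<n}"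
    then have [measurable (raw)]: "j < n" by simp
    show "(\<lambda>w. if j < i then row j w *s v + of_real s *s perp v (w (n + j))
        else \<mu> j *s v + of_real s *s w (n + j)) \<in> borel_measurable base"
      by measurable
  qed
  show "givens_stage i \<in> borel_measurable base" if [measurable (raw)]: "i < n"
    unfolding givens_stage_def
  proof (intro borel_measurable_sum borel_measurable_outer)
    fix j assume "j \<in> {..<n}"
    then have [measurable (raw)]: "j < n" by simp
    show "(\<lambda>w. (if j = 0 then radius i w else if j \<le> i then 0 else row j w) *s v +
        of_real s *s perp v (w (n + j))) \<in> borel_measurable base"
      by measurable
  qed
  show "turn_stage i \<in> borel_measurable base"
    unfolding turn_stage_def
  proof (intro borel_measurable_sum borel_measurable_outer)
    fix j assume "j \<in> {..<n}"
    then have [measurable (raw)]: "j < n" "n - 1 < n" by simp_all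
    show "(\<lambda>w. (if j = 0 then radius (n - 1) w else 0) *s v +
        of_real s *s (if j = 0 \<or> i < j then perp v (w (n + j)) else d j w)) \<in> borel_measurable base"
      by measurable
  qed
qed

text \<open>Reduces an equality in law of neighbouring stages to a pointwise identity: one stage
  evaluated at the rotated sample point is the other.\<close>

lemma base_rotation:
  assumes "i < 3 * n" "j < 3 * n" "i \<noteq> j"
    and "\<And>w. orthogonal_transformation (T w)"
    and "\<And>w x y. T (w(i := x, j := y)) = T w"
    and "(\<lambda>w. T w (w i, w j)) \<in> borel_measurable base"
    and "f \<in> borel_measurable base"
    and "\<And>w. f (w(i := fst (T w (w i, w j)), j := snd (T w (w i, w j)))) = g w"
  shows "distr base borel g = distr base borel f"
  using PiM_gauss_rotation[of "{..<3 * n}" i j T f borel] assms(1-7) unfolding assms(8) base_def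
  by simp

text \<open>Swapping the component of \<open>w (n + i)\<close> along \<open>v\<close> with entry
  \<open>k\<close> of \<open>w i\<close> leaves the projection of \<open>w (n + i)\<close> alone and
  turns its component along \<open>v\<close> into the random part of \<open>row i\<close>.\<close>

lemma split_stage_Suc:
  assumes i: "i < n"
  shows "distr base borel (split_stage (Suc i)) = distr base borel (split_stage i)"
proof (rule base_rotation[where T = "\<lambda>_. exchange v (axis k 1)" and i = "n + i" and j = i])
  show "orthogonal_transformation (exchange v (axis k 1))"
    by (rule orthogonal_transformation_exchange[OF v norm_axis_1])
  show "(\<lambda>w. exchange v (axis k 1) (w (n + i), w i)) \<in> borel_measurable base"
  proof -
    have [measurable]: "(\<lambda>w. w i) \<in> borel_measurable base" "(\<lambda>w. w (n + i)) \<in> borel_measurable base"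
      using i by (auto intro!: coordinate_measurable)
    show ?thesis unfolding exchange_def fst_conv snd_conv by measurable
  qed
  fix w :: "nat \<Rightarrow> complex ^ 'm"
  show "split_stage i (w(n + i := fst (exchange v (axis k 1) (w (n + i), w i)), i := snd (exchange v (axis k 1) (w (n + i), w i)))) =
      split_stage (Suc i) w"
    unfolding split_stage_def
  proof (intro sum.cong refl arg_cong[where f = outer])
    fix j assume "j \<in> {..<n}"
    then show "(if j < i then row j (w(n + i := fst (exchange v (axis k 1) (w (n + i), w i)), i := snd (exchange v (axis k 1) (w (n + i), w i)))) *s v +
          of_real s *s perp v ((w(n + i := fst (exchange v (axis k 1) (w (n + i), w i)), i := snd (exchange v (axis k 1) (w (n + i), w i)))) (n + j))
        else \<mu> j *s v + of_real s *s (w(n + i := fst (exchange v (axis k 1) (w (n + i), w i)), i := snd (exchange v (axis k 1) (w (n + i), w i)))) (n + j)) =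
        (if j < Suc i then row j w *s v + of_real s *s perp v (w (n + j)) else \<mu> j *s v + of_real s *s w (n + j))"
      using i by (cases j i rule: linorder_cases)
        (auto simp: row_def exchange_def perp_def cip_axis vec_eq_iff algebra_simps)
  qed
qed (use i in \<open>auto intro: stage_measurable\<close>)

lemma radius_cong: "(\<And>j. j \<le> i \<Longrightarrow> w j = w' j) \<Longrightarrow> radius i w = radius i w'"
  by (induction i) (simp_all add: row_def)

text \<open>The rotation is determined by the first block and moves only two vectors of the second.
  Applied to columns 0 and \<open>Suc i\<close> it merges their entries along \<open>v\<close> into
  the new radius, and \<open>outer_givens\<close> keeps the matrix unchanged.\<close>

lemma givens_stage_Suc:
  assumes i: "Suc i < n"
  shows "distr base borel (givens_stage i) = distr base borel (givens_stage (Suc i))"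
proof (rule base_rotation[where T = "\<lambda>w. givens (radius i w) (row (Suc i) w)" and i = n and j = "n + Suc i"])
  have [measurable]: "radius i \<in> borel_measurable base" "row (Suc i) \<in> borel_measurable base"
      "(\<lambda>w. w n) \<in> borel_measurable base" "(\<lambda>w. w (n + Suc i)) \<in> borel_measurable base"
    using i by (auto intro!: coordinate_measurable row_measurable radius_measurable)
  show "orthogonal_transformation (givens (radius i w) (row (Suc i) w))" for w
    by (rule orthogonal_transformation_givens)
  show "(\<lambda>w. givens (radius i w) (row (Suc i) w) (w n, w (n + Suc i))) \<in> borel_measurable base"
    unfolding givens_def Let_def fst_conv snd_conv by measurable
  have "radius l (w(n := x, n + Suc i := y)) = radius l w" if "l < n" for l w x y
    using that by (intro radius_cong) auto
  then have upd: "radius i (w(n := x, n + Suc i := y)) = radius i w" "radius (Suc i) (w(n := x, n + Suc i := y)) = radius (Suc i) w"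
    "j < n \<Longrightarrow> row j (w(n := x, n + Suc i := y)) = row j w" for j w x y
    using i by (auto simp del: radius.simps simp: row_def)
  show "givens (radius i (w(n := x, n + Suc i := y))) (row (Suc i) (w(n := x, n + Suc i := y))) =
      givens (radius i w) (row (Suc i) w)" for w x y
    using i upd by simp
  fix w :: "nat \<Rightarrow> complex ^ 'm"
  let ?G = "givens (radius i w) (row (Suc i) w) :: (complex ^ 'm) \<times> (complex ^ 'm) \<Rightarrow> _"
  let ?p = "?G (w n, w (n + Suc i))"
  let ?w = "w(n := fst ?p, n + Suc i := snd ?p)"
  let ?x = "radius i w *s v + of_real s *s perp v (w n)"
  let ?y = "row (Suc i) w *s v + of_real s *s perp v (w (n + Suc i))"
  let ?t = "\<lambda>i w j. outer ((if j = 0 then radius i w else if j \<le> i then 0 else row j w) *s v +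
     of_real s *s perp v (w (n + j)))"
  define \<rho> where "\<rho> = complex_of_real (sqrt ((cmod (radius i w))\<^sup>2 + (cmod (row (Suc i) w))\<^sup>2))"
  have cnj\<rho>: "cnj \<rho> = \<rho>" by (simp add: \<rho>_def)
  have \<rho>2: "\<rho> * \<rho> = radius i w * cnj (radius i w) + row (Suc i) w * cnj (row (Suc i) w)"
    unfolding \<rho>_def complex_norm_square[symmetric] of_real_mult[symmetric] of_real_add[symmetric] by simp
  have rad: "radius (Suc i) w = \<rho>" by (simp add: \<rho>_def)
  \<comment> \<open>Since \<open>perp v\<close> is complex linear, rotating the vectors in the
    second block rotates the orthogonal parts of the columns by the same matrix; the entries along
    \<open>v\<close> become the new radius and 0.\<close>
  have "(radius (Suc i) w *s v + of_real s *s perp v (fst ?p), of_real s *s perp v (snd ?p)) = ?G (?x, ?y)"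
  proof (cases "\<rho> = 0")
    case True
    then have "(cmod (radius i w))\<^sup>2 + (cmod (row (Suc i) w))\<^sup>2 = 0" by (simp add: \<rho>_def)
    then have "radius i w = 0" "row (Suc i) w = 0" by (simp_all add: sum_power2_eq_zero_iff)
    then show ?thesis by (simp add: givens_def)
  next
    case False
    have 1: "(cnj (radius i w) / \<rho>) * radius i w + (cnj (row (Suc i) w) / \<rho>) * row (Suc i) w = \<rho>"
      using False \<rho>2 by (simp add: field_simps)
    have "(cnj (radius i w) / \<rho>) *s ?x + (cnj (row (Suc i) w) / \<rho>) *s ?y =
        ((cnj (radius i w) / \<rho>) * radius i w + (cnj (row (Suc i) w) / \<rho>) * row (Suc i) w) *s v +
        of_real s *s perp v ((cnj (radius i w) / \<rho>) *s w n + (cnj (row (Suc i) w) / \<rho>) *s w (n + Suc i))"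
      by (simp add: perp_add perp_diff perp_scale vec_eq_iff algebra_simps)
    moreover have "(- row (Suc i) w / \<rho>) *s ?x + (radius i w / \<rho>) *s ?y =
        of_real s *s perp v ((- row (Suc i) w / \<rho>) *s w n + (radius i w / \<rho>) *s w (n + Suc i))"
      by (simp add: perp_add perp_diff perp_scale vec_eq_iff algebra_simps)
    ultimately show ?thesis
      using False unfolding givens_def Let_def \<rho>_def[symmetric] rad 1 by (simp add: 1)
  qed
  then have out: "outer (radius (Suc i) w *s v + of_real s *s perp v (fst ?p)) + outer (of_real s *s perp v (snd ?p)) =
      outer ?x + outer ?y"
    using outer_givens[of "radius i w" "row (Suc i) w" ?x ?y] by (metis fst_conv snd_conv)
  have sub: "{0, Suc i} \<subseteq> {..<n}" using i by auto
  have "givens_stage (Suc i) ?w = (\<Sum>j\<in>{..<n} - {0, Suc i}. ?t (Suc i) ?w j) + (\<Sum>j\<in>{0, Suc i}. ?t (Suc i) ?w j)"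
    unfolding givens_stage_def by (rule sum.subset_diff[OF sub]) simp
  also have "(\<Sum>j\<in>{0, Suc i}. ?t (Suc i) ?w j) = (\<Sum>j\<in>{0, Suc i}. ?t i w j)"
    using out i upd(2) by (simp del: radius.simps)
  also have "(\<Sum>j\<in>{..<n} - {0, Suc i}. ?t (Suc i) ?w j) = (\<Sum>j\<in>{..<n} - {0, Suc i}. ?t i w j)"
    using upd by (intro sum.cong refl) auto
  also have "\<dots> + (\<Sum>j\<in>{0, Suc i}. ?t i w j) = givens_stage i w"
    unfolding givens_stage_def by (rule sum.subset_diff[OF sub, symmetric]) simp
  finally show "givens_stage (Suc i) ?w = givens_stage i w" .
qed (use i in \<open>auto intro: stage_measurable\<close>)

text \<open>\<open>turn\<close> depends on \<open>w n\<close> alone, which belongs to column 0, so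
  the swap performed on a later column leaves its own direction unchanged.\<close>

lemma turn_stage_Suc:
  assumes i: "Suc i < n"
  shows "distr base borel (turn_stage (Suc i)) = distr base borel (turn_stage i)"
proof (rule base_rotation[where T = turn and i = "n + Suc i" and j = "2 * n + Suc i"])
  show "orthogonal_transformation (turn w)" for w
    unfolding turn_def using norm_unit_b norm_axis_1 by (auto simp del: of_real_divide intro!: orthogonal_transformation_exchange)
  show "turn (w(n + Suc i := x, 2 * n + Suc i := y)) = turn w" for w x y
    using n by (simp add: turn_def b_def)
  show "(\<lambda>w. turn w (w (n + Suc i), w (2 * n + Suc i))) \<in> borel_measurable base"
    using i by (rule turn_measurable)
  fix w :: "nat \<Rightarrow> complex ^ 'm"
  let ?p = "turn w (w (n + Suc i), w (2 * n + Suc i))"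
  let ?w = "w(n + Suc i := fst ?p, 2 * n + Suc i := snd ?p)"
  have t: "turn ?w = turn w" using n by (simp add: turn_def b_def)
  have r: "radius (n - 1) ?w = radius (n - 1) w" using n by (intro radius_cong) auto
  have d: "d j ?w = d j w" if "j < n" "j \<noteq> Suc i" for j
    unfolding d_def t using that i by simp
  show "turn_stage i ?w = turn_stage (Suc i) w"
    unfolding turn_stage_def r
  proof (intro sum.cong refl arg_cong[where f = outer] arg_cong2[where f = "(+)"] arg_cong2[where f = "(*s)"])
    fix j assume "j \<in> {..<n}"
    then have j: "j < n" by simp
    consider "j = 0 \<or> Suc i < j" | "j = Suc i" | "0 < j" "j \<le> i" by linarith
    then show "(if j = 0 \<or> i < j then perp v (?w (n + j)) else d j ?w) =
        (if j = 0 \<or> Suc i < j then perp v (w (n + j)) else d j w)"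
    proof cases
      case 3
      then show ?thesis using d[OF j] by simp
    qed (use i j in \<open>auto simp: d_def\<close>)
  qed
qed (use i in \<open>auto intro: stage_measurable\<close>)

lemma distr_stages: "distr base borel (turn_stage (n - 1)) = distr base borel (split_stage 0)"
proof -
  have "i \<le> n \<Longrightarrow> distr base borel (split_stage i) = distr base borel (split_stage 0)" for i
    by (induction i) (simp_all add: split_stage_Suc)
  moreover have "i < n \<Longrightarrow> distr base borel (givens_stage i) = distr base borel (givens_stage 0)" for i
    by (induction i) (simp_all flip: givens_stage_Suc)
  moreover have "i < n \<Longrightarrow> distr base borel (turn_stage i) = distr base borel (turn_stage 0)" for i
    by (induction i) (simp_all add: turn_stage_Suc)
  moreover have "split_stage n = givens_stage 0"
    unfolding split_stage_def givens_stage_def by (intro ext sum.cong) auto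
  moreover have "givens_stage (n - 1) = turn_stage 0"
    unfolding givens_stage_def turn_stage_def by (intro ext sum.cong refl) auto
  ultimately show ?thesis using n by (metis diff_less le_refl less_le_trans zero_less_one)
qed

section \<open>The final stage as a rank-one perturbation\<close>

lemma turn_stage_last:
  "turn_stage (n - 1) w = outer (radius (n - 1) w *s v + of_real s *s b w) + s\<^sup>2 *\<^sub>R (\<Sum>j\<in>{1..<n}. outer (d j w))"
proof -
  have "{..<n} = insert 0 {1..<n}" using n by auto
  moreover have "outer (of_real s *s x) = s\<^sup>2 *\<^sub>R outer x" for x :: "complex ^ 'm"
    by (simp add: vec_eq_iff outer_def power2_eq_square) (simp add: scaleR_conv_of_real)
  ultimately show ?thesis
    by (auto simp: turn_stage_def b_def scaleR_sum_right intro!: sum.cong)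
qed

lemma radius_norm: "(cmod (radius i w))\<^sup>2 = (\<Sum>j\<le>i. (cmod (row j w))\<^sup>2)"
  by (induction i) (simp_all add: sum_nonneg)

lemma cip_v_b: "cip v (b w) = 0"
  and cip_v_d: "cip v (d j w) = 0"
  by (simp_all add: b_def d_def perp_orthogonal[OF v])

text \<open>After the swap the component along the unit vector in direction \<open>b w\<close> is
  the reservoir entry, and projecting off \<open>v\<close> keeps it because \<open>b w\<close> is
  orthogonal to \<open>v\<close>. Summed over \<open>j\<close>, this says that Q is B C.\<close>

lemma cip_d_b: "(cmod (cip (d j w) (b w)))\<^sup>2 = (norm (b w))\<^sup>2 * (cmod (w (2 * n + j) $ k))\<^sup>2"
proof (cases "b w = 0")
  case False
  let ?f = "complex_of_real (1 / norm (b w)) *s b w"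
  let ?x = "fst (turn w (w (n + j), w (2 * n + j)))"
  have ff: "cip ?f ?f = 1" using norm_unit_b[OF False] by (simp only: cip_self) simp
  have bv: "cip (b w) v = 0" using cip_v_b cnj_cip by (metis complex_cnj_zero)
  have "?x = w (n + j) + (w (2 * n + j) $ k - cip ?f (w (n + j))) *s ?f"
    using False by (simp add: turn_def exchange_def cip_axis)
  then have "cip ?f ?x = w (2 * n + j) $ k"
    using ff by (simp only: cip_add_right cip_scale_right) simp
  moreover have "cip (b w) (d j w) = of_real (norm (b w)) * cip ?f ?x"
    using False by (simp add: d_def perp_def cip_simps bv)
  ultimately have "cmod (cip (b w) (d j w)) = norm (b w) * cmod (w (2 * n + j) $ k)"
    by (simp add: norm_mult)
  moreover have "cmod (cip (d j w) (b w)) = cmod (cip (b w) (d j w))"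
    by (metis cnj_cip complex_mod_cnj)
  ultimately show ?thesis by (simp add: power_mult_distrib)
qed (simp add: cip_simps)

end

section \<open>The stochastic representation\<close>

lemma distr_PiM_componentwise:
  fixes f :: "'i \<Rightarrow> 'a \<Rightarrow> 'b"
  assumes I: "finite I" and M: "\<And>i. prob_space (M i)" and f: "\<And>i. f i \<in> M i \<rightarrow>\<^sub>M N i"
  shows "distr (PiM I M) (PiM I N) (\<lambda>w. \<lambda>i\<in>I. f i (w i)) = PiM I (\<lambda>i. distr (M i) (N i) (f i))"
proof -
  interpret M: product_prob_space M I by (intro product_prob_spaceI M)
  interpret D: product_prob_space "\<lambda>i. distr (M i) (N i) (f i)" I
    by (intro product_prob_spaceI prob_space.prob_space_distr M f)
  have F: "(\<lambda>w. \<lambda>i\<in>I. f i (w i)) \<in> PiM I M \<rightarrow>\<^sub>M PiM I N"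
  proof (rule measurable_restrict)
    fix i assume "i \<in> I"
    from measurable_component_singleton[OF this, of M]
    show "(\<lambda>w. f i (w i)) \<in> PiM I M \<rightarrow>\<^sub>M N i" by (rule measurable_compose) (rule f)
  qed
  show ?thesis
  proof (rule D.PiM_eqI)
    show "sets (distr (PiM I M) (PiM I N) (\<lambda>w. \<lambda>i\<in>I. f i (w i))) = sets (PiM I (\<lambda>i. distr (M i) (N i) (f i)))"
      by (simp cong: sets_PiM_cong)
    fix A assume A: "\<And>i. i \<in> I \<Longrightarrow> A i \<in> sets (distr (M i) (N i) (f i))"
    have "(\<lambda>w. \<lambda>i\<in>I. f i (w i)) -` Pi\<^sub>E I A \<inter> space (PiM I M) = Pi\<^sub>E I (\<lambda>i. f i -` A i \<inter> space (M i))"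
      by (auto simp: PiE_iff space_PiM)
    then have "emeasure (distr (PiM I M) (PiM I N) (\<lambda>w. \<lambda>i\<in>I. f i (w i))) (Pi\<^sub>E I A) =
        emeasure (PiM I M) (Pi\<^sub>E I (\<lambda>i. f i -` A i \<inter> space (M i)))"
      using A I by (subst emeasure_distr[OF F]) (auto intro!: sets_PiM_I_finite)
    also have "\<dots> = (\<Prod>i\<in>I. emeasure (M i) (f i -` A i \<inter> space (M i)))"
      using A f I by (intro M.emeasure_PiM) (auto intro: measurable_sets)
    also have "\<dots> = (\<Prod>i\<in>I. emeasure (distr (M i) (N i) (f i)) (A i))"
      using A f by (intro prod.cong refl, subst emeasure_distr) auto
    finally show "emeasure (distr (PiM I M) (PiM I N) (\<lambda>w. \<lambda>i\<in>I. f i (w i))) (Pi\<^sub>E I A) =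
        (\<Prod>i\<in>I. emeasure (distr (M i) (N i) (f i)) (A i))" .
  qed (rule I)
qed

text \<open>The limit is tested along sequences, where dominated convergence applies to the
  indicators of the exceptional sets.\<close>

lemma tendsto_zero_in_prob_pointwise:
  fixes X :: "real \<Rightarrow> 'w \<Rightarrow> real"
  assumes M: "prob_space M" and X: "\<And>t. t > 0 \<Longrightarrow> X t \<in> borel_measurable M"
    and lim: "\<And>w. w \<in> space M \<Longrightarrow> ((\<lambda>t. X t w) \<longlongrightarrow> 0) (at_right 0)"
  shows "tendsto_zero_in_prob M X (at_right 0)"
  unfolding tendsto_zero_in_prob_def tendsto_at_iff_sequentially
proof (intro allI impI)
  fix \<epsilon> :: real and T :: "nat \<Rightarrow> real"
  assume \<epsilon>: "\<epsilon> > 0" and T: "\<forall>i. T i \<in> {0<..} - {0}" "T \<longlonglongrightarrow> 0"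
  interpret prob_space M by fact
  let ?S = "\<lambda>i. {w \<in> space M. \<bar>X (T i) w\<bar> > \<epsilon>}"
  have [measurable]: "X (T i) \<in> borel_measurable M" for i using T(1) by (intro X) auto
  have "(\<lambda>i. integral\<^sup>L M (indicator (?S i) :: 'w \<Rightarrow> real)) \<longlonglongrightarrow> integral\<^sup>L M (\<lambda>_. 0 :: real)"
  proof (rule integral_dominated_convergence[where w = "\<lambda>_. 1"])
    show "AE w in M. (\<lambda>i. indicator (?S i) w :: real) \<longlonglongrightarrow> 0"
    proof (rule AE_I2)
      fix w assume w: "w \<in> space M"
      have "(\<lambda>i. X (T i) w) \<longlonglongrightarrow> 0"
        using lim[OF w] T unfolding tendsto_at_iff_sequentially comp_def by blast
      then have "eventually (\<lambda>i. \<bar>X (T i) w\<bar> < \<epsilon>) sequentially"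
        using \<epsilon> by (auto dest!: tendstoD simp: dist_real_def)
      then show "(\<lambda>i. indicator (?S i) w :: real) \<longlonglongrightarrow> 0"
        by (intro tendsto_eventually) (auto elim!: eventually_mono)
    qed
  qed (auto simp: indicator_def)
  then show "((\<lambda>i. measure M {w \<in> space M. \<bar>X i w\<bar> > \<epsilon>}) \<circ> T) \<longlonglongrightarrow> 0"
    by (simp add: comp_def)
qed

text \<open>At a fixed sample point \<kappa> and \<open>c\<close> are constants. The smallness
  condition is \<open>2 * s\<^sup>2 * \<kappa> \<le> p\<close> with s = \<sigma> / sqrt 2; it holds
  for all small \<sigma> because \<open>p\<close> tends to \<omega> > 0. The quotient is then at
  most \<sigma>^2 c / (4 p^2).\<close>

lemma remainder_tendsto_zero:
  fixes R p :: "real \<Rightarrow> real"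
  assumes \<omega>: "\<omega> > 0" and p: "(p \<longlongrightarrow> \<omega>) (at_right 0)"
    and R: "\<And>\<sigma>. \<sigma> > 0 \<Longrightarrow> p \<sigma> > 0 \<Longrightarrow> \<sigma>\<^sup>2 * \<kappa> \<le> p \<sigma> \<Longrightarrow> \<bar>R \<sigma>\<bar> \<le> 2 * (\<sigma> / sqrt 2) ^ 6 * c / (p \<sigma>)\<^sup>2"
  shows "((\<lambda>\<sigma>. R \<sigma> / \<sigma> ^ 4) \<longlongrightarrow> 0) (at_right 0)"
proof (rule Lim_null_comparison)
  have "((\<lambda>\<sigma>. \<sigma>\<^sup>2 * \<kappa>) \<longlongrightarrow> 0\<^sup>2 * \<kappa>) (at_right 0)" by (intro tendsto_intros)
  then have "eventually (\<lambda>\<sigma>. \<sigma>\<^sup>2 * \<kappa> < \<omega> / 2) (at_right 0)"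
    using \<omega> by (intro order_tendstoD(2)[where y = 0]) auto
  moreover have "eventually (\<lambda>\<sigma>. p \<sigma> > \<omega> / 2) (at_right 0)"
    using \<omega> by (intro order_tendstoD(1)[OF p]) simp
  moreover have "eventually (\<lambda>\<sigma>::real. \<sigma> > 0) (at_right 0)"
    by (rule eventually_at_right_less)
  ultimately show "eventually (\<lambda>\<sigma>. norm (R \<sigma> / \<sigma> ^ 4) \<le> \<sigma>\<^sup>2 / 4 * c / (p \<sigma>)\<^sup>2) (at_right 0)"
  proof eventually_elim
    case (elim \<sigma>)
    have "(sqrt 2) ^ 6 = (8 :: real)" using power_mult[of "sqrt 2" 2 3] by simp
    then have eq: "2 * (\<sigma> / sqrt 2) ^ 6 = \<sigma> ^ 4 * (\<sigma>\<^sup>2 / 4)" by (simp add: power_divide flip: power_add)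
    then have "\<bar>R \<sigma>\<bar> \<le> \<sigma> ^ 4 * (\<sigma>\<^sup>2 / 4) * c / (p \<sigma>)\<^sup>2"
      using R[of \<sigma>, unfolded eq] elim \<omega> by simp
    also have "\<dots> = \<sigma> ^ 4 * (\<sigma>\<^sup>2 / 4 * c / (p \<sigma>)\<^sup>2)" by simp
    finally have "\<bar>R \<sigma>\<bar> / \<sigma> ^ 4 \<le> \<sigma>\<^sup>2 / 4 * c / (p \<sigma>)\<^sup>2"
      using elim by (subst pos_divide_le_eq) (simp_all only: zero_less_power mult.commute)
    then show ?case using elim by simp
  qed
  have "((\<lambda>\<sigma>. \<sigma>\<^sup>2 / 4 * c / (p \<sigma>)\<^sup>2) \<longlongrightarrow> 0\<^sup>2 / 4 * c / \<omega>\<^sup>2) (at_right 0)"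
    using \<omega> by (intro tendsto_intros p) auto
  then show "((\<lambda>\<sigma>. \<sigma>\<^sup>2 / 4 * c / (p \<sigma>)\<^sup>2) \<longlongrightarrow> 0) (at_right 0)" by simp
qed

context gaussian_columns
begin

section \<open>Laws and independence of A, B and C\<close>

lemma prob_space_base: "prob_space base"
  unfolding base_def by (intro prob_space_PiM prob_space_gauss)

lemma split_stage_law:
  "distr base borel (split_stage 0) =
    distr (\<Pi>\<^sub>M j\<in>{..<n}. complex_normal (\<mu> j *s v) (mat (complex_of_real ((s * sqrt 2)\<^sup>2)))) borel
      (\<lambda>x. \<Sum>j<n. outer (x j))"
proof -
  let ?G = "\<Pi>\<^sub>M j\<in>{..<n}. gauss :: (complex ^ 'm) measure" and ?B = "\<Pi>\<^sub>M j\<in>{..<n}. borel :: (complex ^ 'm) measure"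
  let ?f = "\<lambda>j x. \<mu> j *s v + s *\<^sub>R x"
  let ?h = "\<lambda>w. \<lambda>j\<in>{..<n}. ?f j (w j)" and ?r = "\<lambda>w. \<lambda>j\<in>{..<n}. w (n + j)"
  have f: "?f j \<in> gauss \<rightarrow>\<^sub>M borel" for j
    by (simp add: measurable_cong_sets[OF sets_gauss refl])
  have h: "?h \<in> ?G \<rightarrow>\<^sub>M ?B"
  proof (rule measurable_restrict)
    fix j assume "j \<in> {..<n}"
    from measurable_component_singleton[OF this, of "\<lambda>_. gauss"]
    show "(\<lambda>w. ?f j (w j)) \<in> ?G \<rightarrow>\<^sub>M borel" by (rule measurable_compose) (rule f)
  qed
  have r: "?r \<in> base \<rightarrow>\<^sub>M ?G"
    unfolding base_def by (intro measurable_restrict measurable_component_singleton) auto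
  have o: "(\<lambda>x. \<Sum>j<n. outer (x j)) \<in> borel_measurable ?B"
    by (intro borel_measurable_sum borel_measurable_outer measurable_component_singleton)
  have "complex_normal (\<mu> j *s v) (mat (complex_of_real ((s * sqrt 2)\<^sup>2))) = distr gauss borel (?f j)" for j
    using complex_normal_affine[of "s * sqrt 2" "\<mu> j *s v"] s by simp
  then have "(\<Pi>\<^sub>M j\<in>{..<n}. complex_normal (\<mu> j *s v) (mat (complex_of_real ((s * sqrt 2)\<^sup>2)))) =
      (\<Pi>\<^sub>M j\<in>{..<n}. distr gauss borel (?f j))"
    by simp
  also have "\<dots> = distr ?G ?B ?h"
    by (rule distr_PiM_componentwise[symmetric]) (use f in \<open>auto intro: prob_space_gauss\<close>)
  also have "?G = distr base ?G ?r"
    unfolding base_def by (rule distr_PiM_reindex[symmetric]) (auto intro: prob_space_gauss simp: inj_on_def)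
  also have "distr \<dots> ?B ?h = distr base ?B (?h \<circ> ?r)"
    by (rule distr_distr[OF h r])
  finally have "distr (\<Pi>\<^sub>M j\<in>{..<n}. complex_normal (\<mu> j *s v) (mat (complex_of_real ((s * sqrt 2)\<^sup>2)))) borel
      (\<lambda>x. \<Sum>j<n. outer (x j)) = distr (distr base ?B (?h \<circ> ?r)) borel (\<lambda>x. \<Sum>j<n. outer (x j))"
    by simp
  also have "\<dots> = distr base borel ((\<lambda>x. \<Sum>j<n. outer (x j)) \<circ> (?h \<circ> ?r))"
    by (rule distr_distr[OF o]) (rule measurable_comp[OF r h])
  also have "(\<lambda>x. \<Sum>j<n. outer (x j)) \<circ> (?h \<circ> ?r) = split_stage 0"
    by (simp add: fun_eq_iff split_stage_def scaleR_eq_cvec_scale)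
  finally show ?thesis by simp
qed

definition chi_A :: "(nat \<Rightarrow> complex ^ 'm) \<Rightarrow> real" where
  "chi_A w = (\<Sum>j<n. (cmod (row j w))\<^sup>2) / s\<^sup>2"

definition chi_B :: "(nat \<Rightarrow> complex ^ 'm) \<Rightarrow> real" where
  "chi_B w = (norm (b w))\<^sup>2"

text \<open>The sum runs over the columns 1 to n - 1, whence the offset 1: column 0 has become
  \<open>z\<close>.\<close>

definition chi_C :: "(nat \<Rightarrow> complex ^ 'm) \<Rightarrow> real" where
  "chi_C w = (\<Sum>j<n - 1. (cmod (w (2 * n + 1 + j) $ k))\<^sup>2)"

lemma chi_A_law: "is_noncentral_chi_squared (2 * n) ((\<Sum>j<n. (cmod (\<mu> j))\<^sup>2) / s\<^sup>2) (distr base borel chi_A)"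
  unfolding is_noncentral_chi_squared_def
proof (intro exI conjI)
  let ?a = "\<lambda>i. (if even i then Re else Im) (\<mu> (i div 2)) / s"
  show "(\<Sum>i<2 * n. (?a i)\<^sup>2) = (\<Sum>j<n. (cmod (\<mu> j))\<^sup>2) / s\<^sup>2"
    unfolding sum_double by (simp add: cmod_power2 sum_divide_distrib add_divide_distrib power_divide)
  have "(cmod (row j w))\<^sup>2 / s\<^sup>2 = (?a (2 * j) + Re (w j $ k))\<^sup>2 + (?a (2 * j + 1) + Im (w j $ k))\<^sup>2" for j w
    unfolding row_def cmod_power2 using s by (simp add: power2_eq_square field_simps)
  then have "chi_A = (\<lambda>w. \<Sum>j<n. (?a (2 * j) + Re (w j $ k))\<^sup>2 + (?a (2 * j + 1) + Im (w j $ k))\<^sup>2)"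
    unfolding chi_A_def sum_divide_distrib by (intro ext sum.cong refl)
  then show "distr base borel chi_A = distr (\<Pi>\<^sub>M i\<in>{..<2 * n}. normal (?a i)) borel (\<lambda>g. \<Sum>i<2 * n. (g i)\<^sup>2)"
    unfolding base_def
    using noncentral_chi_squared_gauss_coordinates[of "\<lambda>j. j" n "{..<3 * n}" ?a k] by simp
qed

lemma chi_B_law: "distr base borel chi_B = chi_squared (2 * CARD('m) - 2)"
proof -
  have "chi_B = (\<lambda>x. (norm (perp v x))\<^sup>2) \<circ> (\<lambda>w. w n)"
    by (simp add: chi_B_def b_def fun_eq_iff)
  then have "distr base borel chi_B = distr base borel ((\<lambda>x. (norm (perp v x))\<^sup>2) \<circ> (\<lambda>w. w n))"
    by simp
  also have "\<dots> = distr (distr base gauss (\<lambda>w. w n)) borel (\<lambda>x. (norm (perp v x))\<^sup>2)"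
    unfolding base_def using n by (intro distr_distr[symmetric] measurable_component_singleton) simp_all
  also have "distr base gauss (\<lambda>w. w n) = gauss"
    unfolding base_def using n by (intro distr_PiM_component prob_space_gauss) auto
  finally show ?thesis by (simp add: chi_squared_norm_perp[OF v])
qed

lemma chi_C_law: "distr base borel chi_C = chi_squared (2 * n - 2)"
proof -
  have "chi_C = (\<lambda>w. \<Sum>j<n - 1. (0 + Re (w (2 * n + 1 + j) $ k))\<^sup>2 + (0 + Im (w (2 * n + 1 + j) $ k))\<^sup>2)"
    by (simp add: chi_C_def fun_eq_iff cmod_power2)
  moreover have J: "inj_on (\<lambda>j. 2 * n + 1 + j) {..<n - 1}" "(\<lambda>j. 2 * n + 1 + j) \<in> {..<n - 1} \<rightarrow> {..<3 * n}"
    by (auto simp: inj_on_def)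
  ultimately show ?thesis
    unfolding base_def chi_squared_def
    using noncentral_chi_squared_gauss_coordinates[OF J, where a = "\<lambda>_. 0" and k = k]
    by (simp add: diff_mult_distrib2)
qed

text \<open>Here and in the next two lemmas the product is taken over the block of coordinates that
  the variable reads, the form in which independence of disjoint blocks can be applied.\<close>

lemma chi_A_measurable: "chi_A \<in> borel_measurable (\<Pi>\<^sub>M i\<in>{..<n}. borel)"
  unfolding chi_A_def row_def by measurable

lemma chi_B_measurable: "chi_B \<in> borel_measurable (\<Pi>\<^sub>M i\<in>{n}. borel)"
  unfolding chi_B_def b_def by measurable

lemma chi_C_measurable: "chi_C \<in> borel_measurable (\<Pi>\<^sub>M i\<in>{2 * n..<3 * n}. borel)"
  unfolding chi_C_def
  by (intro borel_measurable_sum borel_measurable_power measurable_compose[OF _ borel_measurable_norm]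
     borel_measurable_vec_nth_complex measurable_component_singleton) auto

lemma ABC_indep: "prob_space.indep_vars base (\<lambda>_. borel) (\<lambda>i. [chi_A, chi_B, chi_C] ! i) {..<3}"
proof -
  interpret prob_space base by (rule prob_space_base)
  let ?K = "\<lambda>i::nat. [{..<n}, {n}, {2 * n..<3 * n}] ! i"
  have three: "{..<3} = {0, 1, 2 :: nat}" by auto
  have "sets base = sets (\<Pi>\<^sub>M i\<in>{..<3 * n}. borel :: (complex ^ 'm) measure)"
    unfolding base_def by (intro sets_PiM_cong) auto
  moreover have "distr base (\<Pi>\<^sub>M i\<in>{..<3 * n}. borel) (\<lambda>x. \<lambda>i\<in>{..<3 * n}. x i) = base"
  proof -
    have "distr base (\<Pi>\<^sub>M i\<in>{..<3 * n}. borel) (\<lambda>x. \<lambda>i\<in>{..<3 * n}. x i) = distr base base (\<lambda>x. x)"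
      using calculation
      by (intro distr_cong) (auto simp: base_def space_PiM PiE_iff extensional_restrict)
    then show ?thesis by simp
  qed
  moreover have "distr base borel (\<lambda>w. w i) = gauss" if "i < 3 * n" for i
  proof -
    have "distr base borel (\<lambda>w. w i) = distr base gauss (\<lambda>w. w i)" by (rule distr_cong) simp_all
    also have "\<dots> = gauss" unfolding base_def using that by (intro distr_PiM_component prob_space_gauss) auto
    finally show ?thesis .
  qed
  ultimately have "indep_vars (\<lambda>_. borel) (\<lambda>i w. w i) {..<3 * n}"
    using n by (subst indep_vars_iff_distr_eq_PiM') (auto intro!: coordinate_measurable PiM_cong simp: base_def lessThan_empty_iff)
  then have "indep_vars (\<lambda>j. \<Pi>\<^sub>M i\<in>?K j. borel) (\<lambda>j w. restrict (\<lambda>i. w i) (?K j)) {..<3}"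
    by (rule indep_vars_restrict) (use n in \<open>auto simp: three disjoint_family_on_def\<close>)
  then have ind: "indep_vars (\<lambda>_. borel) (\<lambda>j w. ([chi_A, chi_B, chi_C] ! j) (restrict (\<lambda>i. w i) (?K j))) {..<3}"
    by (rule indep_vars_compose2) (use chi_A_measurable chi_B_measurable chi_C_measurable in \<open>auto simp: three\<close>)
  \<comment> \<open>Each variable reads only its own block, so restricting the sample point to that
    block does not change its value.\<close>
  have eq: "(\<lambda>w. ([chi_A, chi_B, chi_C] ! j) (restrict (\<lambda>i. w i) (?K j))) = [chi_A, chi_B, chi_C] ! j" if "j \<in> {..<3}" for j
    using that by (auto simp: three chi_A_def chi_B_def chi_C_def row_def b_def fun_eq_iff intro!: sum.cong)
  show ?thesis by (rule iffD1[OF indep_vars_cong[OF refl eq refl] ind])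
qed

text \<open>Being the exact difference, it makes the representation hold by definition at every
  sample point, including those where A vanishes; what has to be proved is its size.\<close>

definition remainder :: "(nat \<Rightarrow> complex ^ 'm) \<Rightarrow> real" where
  "remainder w = largest_eigenvalue (turn_stage (n - 1) w) - s\<^sup>2 * (chi_A w + chi_B w + chi_B w * chi_C w / chi_A w)"

lemma remainder_measurable: "remainder \<in> borel_measurable base"
proof -
  have ind: "(\<lambda>w. w i) \<in> borel_measurable base" if "i < 3 * n" for i
    using that by (rule coordinate_measurable)
  have [measurable]: "chi_A \<in> borel_measurable base"
    unfolding chi_A_def by (intro borel_measurable_divide borel_measurable_sum borel_measurable_power
      borel_measurable_const measurable_compose[OF row_measurable borel_measurable_norm]) simp
  have [measurable]: "chi_B \<in> borel_measurable base"
    unfolding chi_B_def by measurable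
  have [measurable]: "chi_C \<in> borel_measurable base"
    unfolding chi_C_def using n
    by (intro borel_measurable_sum borel_measurable_power measurable_compose[OF _ borel_measurable_norm]
      borel_measurable_vec_nth_complex ind) auto
  have [measurable]: "(\<lambda>w. largest_eigenvalue (turn_stage (n - 1) w)) \<in> borel_measurable base"
    by (intro borel_measurable_largest_eigenvalue stage_measurable)
      (auto simp: turn_stage_def intro!: hermitian_sum hermitian_outer)
  show ?thesis unfolding remainder_def by measurable
qed

text \<open>Here p = s^2 A, \<beta> = B and Q = B C, so the expansion p + s^2 \<beta> + s^4 Q / p of
  the perturbation lemma is s^2 (A + B + B C / A).\<close>

lemma remainder_le:
  fixes w
  defines "p \<equiv> \<Sum>j<n. (cmod (row j w))\<^sup>2" and "\<kappa> \<equiv> \<Sum>j\<in>{1..<n}. (norm (d j w))\<^sup>2"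
  assumes p: "p > 0" and small: "2 * s\<^sup>2 * \<kappa> \<le> p"
  shows "\<bar>remainder w\<bar> \<le> 2 * s ^ 6 * (\<kappa> * chi_B w * (\<kappa> + chi_B w)) / p\<^sup>2"
proof -
  let ?\<alpha> = "radius (n - 1) w"
  have \<alpha>: "(cmod ?\<alpha>)\<^sup>2 = p"
  proof -
    have "{..n - 1} = {..<n}" using n by auto
    then show ?thesis by (simp add: radius_norm p_def)
  qed
  have Q: "(\<Sum>j\<in>{1..<n}. (cmod (cip (d j w) (b w)))\<^sup>2) = chi_B w * chi_C w"
  proof -
    have "(\<Sum>j<n - 1. (cmod (w (2 * n + 1 + j) $ k))\<^sup>2) = (\<Sum>j\<in>{1..<n}. (cmod (w (2 * n + j) $ k))\<^sup>2)"
      by (rule sum.reindex_bij_witness[of _ "\<lambda>j. j - 1" "\<lambda>j. j + 1"]) auto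
    then show ?thesis unfolding cip_d_b chi_B_def chi_C_def by (simp add: sum_distrib_left)
  qed
  have "\<bar>largest_eigenvalue (turn_stage (n - 1) w) - (p + s\<^sup>2 * chi_B w + s ^ 4 * (chi_B w * chi_C w) / p)\<bar> \<le>
      2 * s ^ 6 * \<kappa> * chi_B w * (\<kappa> + chi_B w) / p\<^sup>2"
    using largest_eigenvalue_perturbation[of v s ?\<alpha> "b w" "{1..<n}" "\<lambda>j. d j w"] v s \<alpha> p small cip_v_b cip_v_d
    unfolding turn_stage_last Q chi_B_def \<kappa>_def by (auto simp del: One_nat_def)
  moreover have "s\<^sup>2 * (chi_A w + chi_B w + chi_B w * chi_C w / chi_A w) = p + s\<^sup>2 * chi_B w + s ^ 4 * (chi_B w * chi_C w) / p"
    using s p unfolding chi_A_def p_def[symmetric] by (simp add: field_simps power2_eq_square power4_eq_xxxx)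
  ultimately show ?thesis by (simp add: remainder_def mult.assoc)
qed

end

theorem proposition2:
  fixes v :: "complex ^ 'm" and n :: nat and \<omega> :: real
  assumes "n \<ge> 1" and "\<omega> > 0" and "norm v = 1"
  shows "\<exists>(M :: (nat \<Rightarrow> complex ^ 'm) measure)
            (H :: real \<Rightarrow> (nat \<Rightarrow> complex ^ 'm) \<Rightarrow> complex ^ 'm ^ 'm) A B C R.
     prob_space M \<and>
     (\<forall>\<sigma>>0.
        H \<sigma> \<in> borel_measurable M \<and>
        is_noncentral_wishart n (mat (complex_of_real (\<sigma>\<^sup>2))) ((\<omega> / \<sigma>\<^sup>2) *\<^sub>R outer v)
          (distr M borel (H \<sigma>)) \<and>
        prob_space.indep_vars M (\<lambda>_. borel) (\<lambda>i. [A \<sigma>, B \<sigma>, C \<sigma>] ! i) {..<3} \<and>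
        is_noncentral_chi_squared (2 * n) (2 * \<omega> / \<sigma>\<^sup>2) (distr M borel (A \<sigma>)) \<and>
        distr M borel (B \<sigma>) = chi_squared (2 * CARD('m) - 2) \<and>
        distr M borel (C \<sigma>) = chi_squared (2 * n - 2) \<and>
        R \<sigma> \<in> borel_measurable M \<and>
        (\<forall>w\<in>space M. largest_eigenvalue (H \<sigma> w) =
           \<sigma>\<^sup>2 / 2 * (A \<sigma> w + B \<sigma> w + B \<sigma> w * C \<sigma> w / A \<sigma> w) + R \<sigma> w)) \<and>
     tendsto_zero_in_prob M (\<lambda>\<sigma> w. R \<sigma> w / \<sigma> ^ 4) (at_right 0)"
proof -
  obtain k :: 'm where True by simp
  \<comment> \<open>The law depends on the means only through the non-centrality matrix, so all of
    \<omega> may be put into column 0.\<close>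
  define \<mu> where "\<mu> j = (if j = 0 then complex_of_real (sqrt \<omega>) else 0)" for j :: nat
  define M where "M = (gaussian_columns.base n :: (nat \<Rightarrow> complex ^ 'm) measure)"
  define H where "H \<sigma> = gaussian_columns.turn_stage v k n (\<sigma> / sqrt 2) \<mu> (n - 1)" for \<sigma> :: real
  define A where "A \<sigma> = gaussian_columns.chi_A k n (\<sigma> / sqrt 2) \<mu>" for \<sigma> :: real
  \<comment> \<open>B and C are the same random variables for every \<sigma>; only A varies.\<close>
  define B where "B = (\<lambda>_::real. gaussian_columns.chi_B v n)"
  define C where "C = (\<lambda>_::real. gaussian_columns.chi_C k n)"
  define R where "R \<sigma> = gaussian_columns.remainder v k n (\<sigma> / sqrt 2) \<mu>" for \<sigma> :: real
  have loc: "gaussian_columns v n (\<sigma> / sqrt 2)" if "\<sigma> > 0" for \<sigma> :: real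
    using assms that by unfold_locales simp_all
  have n0: "{..<n} = insert 0 {1..<n}" using assms(1) by auto
  have \<mu>_sq: "(\<Sum>j<n. (cmod (\<mu> j))\<^sup>2) = \<omega>"
    unfolding n0 using assms(2) by (simp add: \<mu>_def)
  have wishart: "is_noncentral_wishart n (mat (complex_of_real (\<sigma>\<^sup>2))) ((\<omega> / \<sigma>\<^sup>2) *\<^sub>R outer v) (distr M borel (H \<sigma>))"
    if \<sigma>: "\<sigma> > 0" for \<sigma>
    unfolding is_noncentral_wishart_def
  proof (intro exI conjI)
    interpret gaussian_columns v k n "\<sigma> / sqrt 2" \<mu> by (rule loc[OF \<sigma>])
    have "(\<Sum>j<n. outer (\<mu> j *s v)) = \<omega> *\<^sub>R outer v"
      unfolding n0 using assms(2) by (simp add: \<mu>_def vec_eq_iff outer_def) (simp add: scaleR_conv_of_real flip: of_real_mult)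
    then show "(\<omega> / \<sigma>\<^sup>2) *\<^sub>R outer v = matrix_inv (mat (complex_of_real (\<sigma>\<^sup>2))) ** (\<Sum>j<n. outer (\<mu> j *s v))"
      using \<sigma> by (simp add: matrix_inv_mat matrix_eq mat_mult_vec scaleR_matrix_mult_vec flip: matrix_vector_mul_assoc)
    show "distr M borel (H \<sigma>) = distr (\<Pi>\<^sub>M j\<in>{..<n}. complex_normal (\<mu> j *s v) (mat (complex_of_real (\<sigma>\<^sup>2)))) borel (\<lambda>x. \<Sum>j<n. outer (x j))"
      using split_stage_law distr_stages unfolding M_def H_def by simp
  qed
  have "prob_space M"
    unfolding M_def by (rule gaussian_columns.prob_space_base[OF loc[of 1]]) simp
  moreover have "tendsto_zero_in_prob M (\<lambda>\<sigma> w. R \<sigma> w / \<sigma> ^ 4) (at_right 0)"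
  proof (rule tendsto_zero_in_prob_pointwise[OF \<open>prob_space M\<close>])
    show "(\<lambda>w. R \<sigma> w / \<sigma> ^ 4) \<in> borel_measurable M" if "\<sigma> > 0" for \<sigma>
      using gaussian_columns.remainder_measurable[OF loc[OF that], of k \<mu>] unfolding R_def M_def by measurable
    fix w assume "w \<in> space M"
    \<comment> \<open>At the fixed sample point \<open>w\<close> only \<open>?p\<close> depends on
      \<sigma>, and at \<sigma> = 0 it is the sum of the |\<mu> j|^2, which is \<omega>.\<close>
    let ?p = "\<lambda>\<sigma>. \<Sum>j<n. (cmod (\<mu> j + complex_of_real (\<sigma> / sqrt 2) * (w j $ k)))\<^sup>2"
    let ?\<kappa> = "\<Sum>j\<in>{1..<n}. (norm (gaussian_columns.d v k n j w))\<^sup>2" and ?\<beta> = "gaussian_columns.chi_B v n w"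
    show "((\<lambda>\<sigma>. R \<sigma> w / \<sigma> ^ 4) \<longlongrightarrow> 0) (at_right 0)"
    proof (rule remainder_tendsto_zero[OF assms(2), where p = ?p and \<kappa> = ?\<kappa> and c = "?\<kappa> * ?\<beta> * (?\<kappa> + ?\<beta>)"])
      have "(?p \<longlongrightarrow> (\<Sum>j<n. (cmod (\<mu> j + complex_of_real (0 / sqrt 2) * (w j $ k)))\<^sup>2)) (at_right 0)"
        by (intro tendsto_intros) simp
      then show "(?p \<longlongrightarrow> \<omega>) (at_right 0)" by (simp add: \<mu>_sq)
      fix \<sigma> :: real assume \<sigma>: "\<sigma> > 0" and p: "?p \<sigma> > 0" "\<sigma>\<^sup>2 * ?\<kappa> \<le> ?p \<sigma>"
      interpret gaussian_columns v k n "\<sigma> / sqrt 2" \<mu> by (rule loc[OF \<sigma>])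
      have "2 * (\<sigma> / sqrt 2)\<^sup>2 * ?\<kappa> \<le> ?p \<sigma>" using p(2) by (simp add: power_divide)
      then show "\<bar>R \<sigma> w\<bar> \<le> 2 * (\<sigma> / sqrt 2) ^ 6 * (?\<kappa> * ?\<beta> * (?\<kappa> + ?\<beta>)) / (?p \<sigma>)\<^sup>2"
        using remainder_le[of w] p(1) unfolding row_def R_def by blast
    qed
  qed
  moreover have "H \<sigma> \<in> borel_measurable M \<and>
        is_noncentral_wishart n (mat (complex_of_real (\<sigma>\<^sup>2))) ((\<omega> / \<sigma>\<^sup>2) *\<^sub>R outer v)
          (distr M borel (H \<sigma>)) \<and>
        prob_space.indep_vars M (\<lambda>_. borel) (\<lambda>i. [A \<sigma>, B \<sigma>, C \<sigma>] ! i) {..<3} \<and>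
        is_noncentral_chi_squared (2 * n) (2 * \<omega> / \<sigma>\<^sup>2) (distr M borel (A \<sigma>)) \<and>
        distr M borel (B \<sigma>) = chi_squared (2 * CARD('m) - 2) \<and>
        distr M borel (C \<sigma>) = chi_squared (2 * n - 2) \<and>
        R \<sigma> \<in> borel_measurable M \<and>
        (\<forall>w\<in>space M. largest_eigenvalue (H \<sigma> w) =
           \<sigma>\<^sup>2 / 2 * (A \<sigma> w + B \<sigma> w + B \<sigma> w * C \<sigma> w / A \<sigma> w) + R \<sigma> w)" if \<sigma>: "\<sigma> > 0" for \<sigma>
  proof -
    interpret gaussian_columns v k n "\<sigma> / sqrt 2" \<mu> by (rule loc[OF \<sigma>])
    have ABC: "A \<sigma> = chi_A" "B \<sigma> = chi_B" "C \<sigma> = chi_C" by (simp_all add: A_def B_def C_def)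
    have s2: "(\<sigma> / sqrt 2)\<^sup>2 = \<sigma>\<^sup>2 / 2" by (simp add: power_divide)
    have "is_noncentral_chi_squared (2 * n) (2 * \<omega> / \<sigma>\<^sup>2) (distr M borel chi_A)"
      using chi_A_law unfolding \<mu>_sq s2 M_def by (simp add: mult.commute)
    moreover have "largest_eigenvalue (H \<sigma> w) = \<sigma>\<^sup>2 / 2 * (chi_A w + chi_B w + chi_B w * chi_C w / chi_A w) + R \<sigma> w" for w
      unfolding H_def R_def remainder_def s2 by simp
    moreover have "H \<sigma> \<in> borel_measurable M" "R \<sigma> \<in> borel_measurable M"
      unfolding H_def R_def M_def by (rule stage_measurable remainder_measurable)+
    ultimately show ?thesis
      using wishart[OF \<sigma>] chi_B_law chi_C_law ABC_indep unfolding ABC M_def by blast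
  qed
  ultimately show ?thesis by blast
qed

end
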